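(* Let $d\in\mathbb{N}$, $\gamma\in\mathbb{R}$ and $\alpha\in\mathbb{R}$ satisfy $\gamma>-\min(2,d)$ and $\alpha>\alpha_F(d,\gamma):=1+\frac{2+\gamma}{d}$. Let $q\in[1,\infty]$ and $s\in\mathbb{R}$ satisfy $$\alpha\le q\le\infty,\qquad \frac1q<\min\left\{\frac{2}{d(\alpha-1)},\ \frac{2}{d(\alpha-1)}+\frac{(d-2)\alpha-d-\gamma}{d(\alpha-1)^2}\right\},$$ $$s_c-\frac{d(\alpha-1)}{\alpha}\left(\frac{2}{d(\alpha-1)}-\frac1q\right)\le s<\min\left\{s_c,\ s_c+\frac{(d-2)\alpha-d-\gamma}{\alpha(\alpha-1)}\right\},\qquad s_c:=\frac{2+\gamma}{\alpha-1}-\frac dq,$$ and let $\varepsilon_0>0$ be the small-data constant (depending only on $d,\gamma,\alpha,q,s$) described in the context. Let $\varphi(x):=\omega(x)|x|^{-\frac{2+\gamma}{\alpha-1}}$, where $\omega\in L^\infty(\mathbb{R}^d)$ is homogeneous of degree $0$ and $\|\omega\|_{L^\infty}$ is sufficiently small so that $\|e^{t\Delta}\varphi\|_{\mathcal{K}^s}<\varepsilon_0$. Then there exists a self-similar solution $u_{\mathcal{S}}$ of $\partial_tu-\Delta u=|x|^\gamma|u|^{\alpha-1}u$ with the initial data $\varphi$ such that $u_{\mathcal{S}}(t)\to\varphi$ in $\mathcal{S}'(\mathbb{R}^d)$ as $t\to0$.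
   Context: For $s\in\mathbb{R}$, $q\in[1,\infty]$, $\|f\|_{L^q_s}:=\||x|^sf\|_{L^q(\mathbb{R}^d)}$, and $L^q_s(\mathbb{R}^d)$ is the space of measurable $f$ with finite norm. $e^{t\Delta}\varphi:=g_t*\varphi$ with $g_t(x)=(4\pi t)^{-d/2}e^{-|x|^2/(4t)}$ (by duality on $\mathcal{S}'(\mathbb{R}^d)$). $\|u\|_{\mathcal{K}^s}:=\sup_{t>0}t^{\frac{s_c-s}{2}}\|u(t)\|_{L^q_s}$, and $\mathcal{K}^s$ is the corresponding space of $u$ on $[0,\infty)\times\mathbb{R}^d$. A solution with initial data $u_0$ means a solution of the integral equation $$u(t)=e^{t\Delta}u_0+\int_0^te^{(t-\tau)\Delta}\left\{|\cdot|^\gamma|u(\tau)|^{\alpha-1}u(\tau)\right\}d\tau .$$ The small-data constant $\varepsilon_0=\varepsilon_0(d,\gamma,\alpha,q,s)>0$ is the one from the small-data global existence result: if $u_0\in\mathcal{S}'(\mathbb{R}^d)$ satisfies $\|e^{t\Delta}u_0\|_{\mathcal{K}^s}<\varepsilon_0$, then there is a global solution $u$ of the integral equation with $\|u\|_{\mathcal{K}^s}\le2\varepsilon_0$ (obtained by Banach's fixed point theorem, $\varepsilon_0$ being a sufficiently small constant). A (forward) self-similar solution is a solution $u$ with $u_\lambda=u$ for all $\lambda>0$, where $u_\lambda(t,x):=\lambda^{\frac{2+\gamma}{\alpha-1}}u(\lambda^2t,\lambda x)$. *)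

theory Defs
  imports "HOL-Analysis.Analysis" "HOL-Probability.Essential_Supremum"
begin

text \<open>
  Space is a Euclidean space \<^typ>\<open>'a\<close> with \<open>d = DIM('a)\<close>. Functions take values in a type
  \<^typ>\<open>'b\<close> that is both a \<^class>\<open>real_normed_field\<close> and a \<^class>\<open>euclidean_space\<close>, that is,
  in the real or the complex numbers, so that both scalar fields are covered.
\<close>

section \<open>Schwartz functions and tempered distributions\<close>

fun iter_pderiv :: "'a::euclidean_space list \<Rightarrow> ('a \<Rightarrow> 'b::real_normed_vector) \<Rightarrow> 'a \<Rightarrow> 'b" where
  "iter_pderiv [] f = f"
| "iter_pderiv (b # bs) f = (\<lambda>x. frechet_derivative (iter_pderiv bs f) (at x) b)"

definition schwartz_seminorm ::
  "nat \<Rightarrow> 'a::euclidean_space list \<Rightarrow> ('a \<Rightarrow> 'b::real_normed_vector) \<Rightarrow> real" where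
  "schwartz_seminorm m bs f = (SUP x. (1 + norm x) ^ m * norm (iter_pderiv bs f x))"

definition schwartz :: "('a::euclidean_space \<Rightarrow> 'b::real_normed_vector) set" where
  "schwartz = {f. \<forall>bs\<in>lists Basis.
     (\<forall>x. iter_pderiv bs f differentiable (at x)) \<and>
     (\<forall>m::nat. bdd_above (range (\<lambda>x. (1 + norm x) ^ m * norm (iter_pderiv bs f x))))}"

text \<open>
  A tempered distribution is a linear functional on the Schwartz space that is continuous, or
  equivalently (the Schwartz space being metrizable) sequentially continuous. It is encoded as a
  functional on all functions; its values off \<^const>\<open>schwartz\<close> play no role.
\<close>

definition tempered_distribution ::
  "(('a::euclidean_space \<Rightarrow> 'b::{real_normed_field,euclidean_space}) \<Rightarrow> 'b) \<Rightarrow> bool" where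
  "tempered_distribution T \<longleftrightarrow>
     (\<forall>f\<in>schwartz. \<forall>g\<in>schwartz. T (\<lambda>x. f x + g x) = T f + T g) \<and>
     (\<forall>c. \<forall>f\<in>schwartz. T (\<lambda>x. c * f x) = c * T f) \<and>
     (\<forall>F f. (\<forall>n::nat. F n \<in> schwartz) \<longrightarrow> f \<in> schwartz \<longrightarrow>
        (\<forall>m. \<forall>bs\<in>lists Basis. (\<lambda>n. schwartz_seminorm m bs (\<lambda>x. F n x - f x)) \<longlonglongrightarrow> 0) \<longrightarrow>
        (\<lambda>n. T (F n)) \<longlonglongrightarrow> T f)"

definition regular_dist ::
  "('a::euclidean_space \<Rightarrow> 'b::{real_normed_field,euclidean_space}) \<Rightarrow> ('a \<Rightarrow> 'b) \<Rightarrow> 'b" where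
  "regular_dist f \<psi> = (\<integral>x. f x * \<psi> x \<partial>lebesgue)"

definition tempered_function ::
  "('a::euclidean_space \<Rightarrow> 'b::{real_normed_field,euclidean_space}) \<Rightarrow> bool" where
  "tempered_function f \<longleftrightarrow>
     f \<in> borel_measurable lebesgue \<and>
     (\<forall>\<psi>\<in>schwartz. integrable lebesgue (\<lambda>x. f x * \<psi> x)) \<and>
     tempered_distribution (regular_dist f)"

definition represents ::
  "('a::euclidean_space \<Rightarrow> 'b::{real_normed_field,euclidean_space}) \<Rightarrow> (('a \<Rightarrow> 'b) \<Rightarrow> 'b) \<Rightarrow> bool" where
  "represents f T \<longleftrightarrow> tempered_function f \<and> (\<forall>\<psi>\<in>schwartz. T \<psi> = regular_dist f \<psi>)"

definition tends_to_initial ::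
  "(real \<Rightarrow> 'a::euclidean_space \<Rightarrow> 'b::{real_normed_field,euclidean_space}) \<Rightarrow> (('a \<Rightarrow> 'b) \<Rightarrow> 'b) \<Rightarrow> bool" where
  "tends_to_initial u T \<longleftrightarrow>
     (\<forall>t>0. tempered_function (u t)) \<and>
     (\<forall>\<psi>\<in>schwartz. ((\<lambda>t. regular_dist (u t) \<psi>) \<longlongrightarrow> T \<psi>) (at_right 0))"

section \<open>Heat semigroup\<close>

definition heat_kernel :: "real \<Rightarrow> 'a::euclidean_space \<Rightarrow> real" where
  "heat_kernel t x = (4 * pi * t) powr (- real DIM('a) / 2) * exp (- (norm x)\<^sup>2 / (4 * t))"

definition heat ::
  "real \<Rightarrow> ('a::euclidean_space \<Rightarrow> 'b::{real_normed_field,euclidean_space}) \<Rightarrow> 'a \<Rightarrow> 'b" where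
  "heat t f x = (\<integral>y. heat_kernel t (x - y) *\<^sub>R f y \<partial>lebesgue)"

definition heat_dist ::
  "real \<Rightarrow> (('a::euclidean_space \<Rightarrow> 'b::{real_normed_field,euclidean_space}) \<Rightarrow> 'b) \<Rightarrow> ('a \<Rightarrow> 'b) \<Rightarrow> 'b" where
  "heat_dist t T \<psi> = T (heat t \<psi>)"

section \<open>Weighted Lebesgue spaces and the space \<open>K\<^sup>s\<close>\<close>

text \<open>The real number \<open>1/q\<close>, which is \<open>0\<close> for \<open>q = \<infinity>\<close>.\<close>

definition recip :: "ennreal \<Rightarrow> real" where
  "recip q = enn2real (inverse q)"

definition Lq_norm :: "ennreal \<Rightarrow> ('a::euclidean_space \<Rightarrow> 'b::real_normed_vector) \<Rightarrow> ennreal" where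
  "Lq_norm q f =
     (if q = \<infinity> then esssup lebesgue (\<lambda>x. ennreal (norm (f x)))
      else let I = (\<integral>\<^sup>+x. ennreal (norm (f x) powr enn2real q) \<partial>lebesgue)
           in if I = \<infinity> then \<infinity> else ennreal (enn2real I powr recip q))"

definition wLq_norm ::
  "ennreal \<Rightarrow> real \<Rightarrow> ('a::euclidean_space \<Rightarrow> 'b::real_normed_vector) \<Rightarrow> ennreal" where
  "wLq_norm q s f = Lq_norm q (\<lambda>x. (norm x powr s) *\<^sub>R f x)"

definition crit_s :: "nat \<Rightarrow> real \<Rightarrow> real \<Rightarrow> ennreal \<Rightarrow> real" where
  "crit_s d \<gamma> \<alpha> q = (2 + \<gamma>) / (\<alpha> - 1) - real d * recip q"

definition Ks_norm ::
  "real \<Rightarrow> real \<Rightarrow> ennreal \<Rightarrow> real \<Rightarrow> (real \<Rightarrow> 'a::euclidean_space \<Rightarrow> 'b::real_normed_vector) \<Rightarrow> ennreal" where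
  "Ks_norm \<gamma> \<alpha> q s u =
     (SUP t\<in>{0<..}. ennreal (t powr ((crit_s DIM('a) \<gamma> \<alpha> q - s) / 2)) * wLq_norm q s (u t))"

definition Ks ::
  "real \<Rightarrow> real \<Rightarrow> ennreal \<Rightarrow> real \<Rightarrow>
   (real \<Rightarrow> 'a::euclidean_space \<Rightarrow> 'b::{real_normed_field,euclidean_space}) set" where
  "Ks \<gamma> \<alpha> q s =
     {u. (\<lambda>(t, x). u t x) \<in> borel_measurable (lebesgue_on ({0<..} \<times> UNIV)) \<and>
         (\<forall>t>0. u t \<in> borel_measurable lebesgue) \<and>
         Ks_norm \<gamma> \<alpha> q s u < \<infinity>}"

text \<open>
  The \<open>K\<^sup>s\<close> norm of the free evolution \<open>t \<mapsto> e\<^bsup>t\<Delta>\<^esup> u\<^sub>0\<close> of a distribution: the norm of the function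
  representing it (unique up to null sets for each \<open>t\<close>, so the infimum ranges over one value), and
  \<open>\<infinity>\<close> if no element of \<open>K\<^sup>s\<close> represents it.
\<close>

definition heat_Ks_norm ::
  "real \<Rightarrow> real \<Rightarrow> ennreal \<Rightarrow> real \<Rightarrow>
   (('a::euclidean_space \<Rightarrow> 'b::{real_normed_field,euclidean_space}) \<Rightarrow> 'b) \<Rightarrow> ennreal" where
  "heat_Ks_norm \<gamma> \<alpha> q s u0 =
     (INF v\<in>{v \<in> Ks \<gamma> \<alpha> q s. \<forall>t>0. represents (v t) (heat_dist t u0)}. Ks_norm \<gamma> \<alpha> q s v)"

section \<open>Solutions of the integral equation\<close>

definition nonlin :: "real \<Rightarrow> real \<Rightarrow> ('a::euclidean_space \<Rightarrow> 'b::real_normed_vector) \<Rightarrow> 'a \<Rightarrow> 'b" where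
  "nonlin \<gamma> \<alpha> w x = (norm x powr \<gamma> * norm (w x) powr (\<alpha> - 1)) *\<^sub>R w x"

text \<open>
  The integral equation holds for every \<open>t > 0\<close> and almost every \<open>x\<close>, the double integral over
  \<open>(0,t) \<times> \<real>\<^sup>d\<close> being absolutely convergent. The function \<open>v\<close> is \<open>e\<^bsup>t\<Delta>\<^esup> u\<^sub>0\<close>. A solution is a
  function on \<open>t > 0\<close> only, as at \<open>t = 0\<close> the equation merely says that \<open>u(0)\<close> is the distribution \<open>u\<^sub>0\<close>.
\<close>

definition solution ::
  "real \<Rightarrow> real \<Rightarrow> (('a::euclidean_space \<Rightarrow> 'b::{real_normed_field,euclidean_space}) \<Rightarrow> 'b) \<Rightarrow>
   (real \<Rightarrow> 'a \<Rightarrow> 'b) \<Rightarrow> bool" where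
  "solution \<gamma> \<alpha> u0 u \<longleftrightarrow>
     (\<lambda>(t, x). u t x) \<in> borel_measurable (lebesgue_on ({0<..} \<times> UNIV)) \<and>
     (\<forall>t>0. \<exists>v. represents v (heat_dist t u0) \<and>
        (AE x in lebesgue.
           set_integrable lebesgue ({0<..<t} \<times> UNIV)
             (\<lambda>(\<tau>, y). heat_kernel (t - \<tau>) (x - y) *\<^sub>R nonlin \<gamma> \<alpha> (u \<tau>) y) \<and>
           u t x = v x +
             set_lebesgue_integral lebesgue {0<..<t} (\<lambda>\<tau>. heat (t - \<tau>) (nonlin \<gamma> \<alpha> (u \<tau>)) x)))"

definition self_similar ::
  "real \<Rightarrow> real \<Rightarrow> (real \<Rightarrow> 'a::euclidean_space \<Rightarrow> 'b::real_normed_vector) \<Rightarrow> bool" where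
  "self_similar \<gamma> \<alpha> u \<longleftrightarrow>
     (\<forall>\<mu>>0. \<forall>t>0. AE x in lebesgue.
        (\<mu> powr ((2 + \<gamma>) / (\<alpha> - 1))) *\<^sub>R u (\<mu>\<^sup>2 * t) (\<mu> *\<^sub>R x) = u t x)"

text \<open>
  The small-data constants: whenever \<open>\<parallel>e\<^bsup>t\<Delta>\<^esup> u\<^sub>0\<parallel> < \<epsilon>\<^sub>0\<close> there is a global solution with norm at most
  \<open>2 \<epsilon>\<^sub>0\<close>. That solution is the fixed point given by Banach's theorem in the closed ball of
  radius \<open>2 \<epsilon>\<^sub>0\<close> of \<open>K\<^sup>s\<close>, hence it is the only solution in that ball. The type argument fixes
  the space and the scalar field.
\<close>

definition small_data_constant ::
  "('a::euclidean_space \<Rightarrow> 'b::{real_normed_field,euclidean_space}) itself \<Rightarrow>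
   real \<Rightarrow> real \<Rightarrow> ennreal \<Rightarrow> real \<Rightarrow> real \<Rightarrow> bool" where
  "small_data_constant T \<gamma> \<alpha> q s \<epsilon> \<longleftrightarrow> \<epsilon> > 0 \<and>
     (\<forall>u0 :: ('a \<Rightarrow> 'b) \<Rightarrow> 'b.
        tempered_distribution u0 \<longrightarrow> heat_Ks_norm \<gamma> \<alpha> q s u0 < ennreal \<epsilon> \<longrightarrow>
        (let S = {u \<in> Ks \<gamma> \<alpha> q s. Ks_norm \<gamma> \<alpha> q s u \<le> ennreal (2 * \<epsilon>) \<and> solution \<gamma> \<alpha> u0 u} in
           S \<noteq> {} \<and>
           (\<forall>u\<in>S. \<forall>w\<in>S. \<forall>t>0. AE x in lebesgue. u t x = w t x)))"

end

theory Submission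
  imports Defs "HOL-Probability.Distributions"
begin

text \<open>
  Put \<open>\<beta> = (2 + \<gamma>) / (\<alpha> - 1)\<close>. The equation is invariant under \<open>u\<^sub>k(t, x) = k\<^sup>\<beta> u(k\<^sup>2 t, k x)\<close>, the norm of
  \<open>K\<^sup>s\<close> is invariant too, and the data \<open>\<phi>\<close> are homogeneous of degree \<open>-\<beta>\<close>, so that their free evolution is
  self-similar. Hence, if \<open>u\<close> is the solution in the ball of radius \<open>2 \<epsilon>\<^sub>0\<close> given by the small-data result,
  each \<open>u\<^sub>k\<close> is a solution with the same data in the same ball (\<open>solution_rescale\<close>, \<open>rescale_Ks\<close>), and
  uniqueness in the ball yields \<open>u\<^sub>k = u\<close>. The supercriticality \<open>\<alpha> > 1 + (2 + \<gamma>) / d\<close> means \<open>\<beta> < d\<close>; this makes \<open>\<phi>\<close> locally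
  integrable, hence a tempered distribution (\<open>homogeneous_data_weighted_integrable\<close>).

  The initial trace needs two limits. The free part, paired with a Schwartz function \<open>\<psi>\<close>, is the integral of
  \<open>\<phi> e\<^sup>t\<^sup>\<Delta> \<psi>\<close> and converges to that of \<open>\<phi> \<psi>\<close> by dominated convergence (\<open>regular_dist_heat_tendsto\<close>). For the
  Duhamel part a direct argument from self-similarity replaces weighted Hoelder estimates. The source \<open>\<bar>y\<bar>\<^sup>\<gamma> \<bar>u\<bar>\<^sup>\<alpha>\<close> is
  integrable on \<open>(0, T) \<times> B(R)\<close>, because the Duhamel integral converges absolutely at some point and the
  heat kernel is bounded below there (\<open>source_locally_integrable\<close>). Self-similarity upgrades this to polynomial growth of the
  mass of the source in \<open>R\<close> (\<open>source_growth\<close>), so that the source is integrable on \<open>(0, T) \<times> \<real>\<^sup>d\<close> against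
  the weight \<open>(1 + \<bar>y\<bar>)\<close> to the power \<open>-(d + 2)\<close> (\<open>weighted_source_finite\<close>). The heat semigroup preserves this
  weight up to a constant (\<open>heat_decay_le\<close>), and Schwartz functions are dominated by it. By Tonelli's theorem the Duhamel
  part is a tempered function whose pairing with \<open>\<psi>\<close> is at most a constant times the weighted mass of
  the source up to time \<open>t\<close>, which vanishes as \<open>t \<rightarrow> 0\<close> (\<open>self_similar_tends_to_initial\<close>).
\<close>

section \<open>Dilations and Lebesgue measure\<close>

text \<open>
  An axis-parallel dilation with one factor per basis vector, so that the isotropic map
  \<open>x \<mapsto> k x\<close> of space and the parabolic map \<open>(\<tau>, y) \<mapsto> (k\<^sup>2 \<tau>, k y)\<close> of space-time are both instances.
\<close>

definition dilation :: "('a::euclidean_space \<Rightarrow> real) \<Rightarrow> 'a \<Rightarrow> 'a" where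
  "dilation c x = (\<Sum>j\<in>Basis. (c j * (x \<bullet> j)) *\<^sub>R j)"

lemma dilation_const: "dilation (\<lambda>_. k) x = k *\<^sub>R x"
  unfolding dilation_def scaleR_scaleR[symmetric] scaleR_sum_right[symmetric] euclidean_representation ..

lemma dilation_inverse:
  assumes "\<And>j. j \<in> Basis \<Longrightarrow> c j \<noteq> 0"
  shows "dilation c (dilation (\<lambda>j. 1 / c j) x) = x"
proof (rule euclidean_eqI)
  fix i :: 'a assume i: "i \<in> Basis"
  have "dilation c y \<bullet> i = c i * (y \<bullet> i)" for c :: "'a \<Rightarrow> real" and y
    unfolding dilation_def using i by (subst inner_sum_left_Basis) auto
  then show "dilation c (dilation (\<lambda>j. 1 / c j) x) \<bullet> i = x \<bullet> i"
    using assms[OF i] by simp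
qed

lemma dilation_measurable_lebesgue:
  assumes "\<And>j. j \<in> Basis \<Longrightarrow> c j \<noteq> 0"
  shows "dilation c \<in> lebesgue \<rightarrow>\<^sub>M lebesgue"
  using lebesgue_affine_measurable[of c 0] assms by (simp add: dilation_def[abs_def])

lemma lebesgue_eq_dilation:
  assumes "\<And>j. j \<in> Basis \<Longrightarrow> c j \<noteq> 0"
  shows "lebesgue = density (distr lebesgue lebesgue (dilation c)) (\<lambda>_. ennreal (\<Prod>j\<in>Basis. \<bar>c j\<bar>))"
  using lebesgue_affine_euclidean[of c 0] assms by (simp add: dilation_def[abs_def])

lemma AE_dilation:
  assumes c: "\<And>j. j \<in> Basis \<Longrightarrow> c j \<noteq> 0" and P: "AE x in lebesgue. P x"
  shows "AE x in lebesgue. P (dilation c x)"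
proof -
  have "0 < (\<Prod>j\<in>Basis. \<bar>c j\<bar>)" using c by (auto intro!: prod_pos)
  moreover have "AE x in density (distr lebesgue lebesgue (dilation c)) (\<lambda>_. ennreal (\<Prod>j\<in>Basis. \<bar>c j\<bar>)). P x"
    using P by (subst (asm) lebesgue_eq_dilation[of c]) (use c in auto)
  ultimately have "AE x in distr lebesgue lebesgue (dilation c). P x"
    by (simp add: AE_density)
  from AE_distrD[OF dilation_measurable_lebesgue[OF c] this] show ?thesis .
qed

text \<open>
  The equivalence, not just one implication, is what makes the substitution rules below hold for
  arbitrary integrands: a function that is not measurable has integral \<open>0\<close> on both sides.
\<close>

lemma borel_measurable_dilation_iff:
  fixes f :: "'a::euclidean_space \<Rightarrow> 'b::topological_space"
  assumes c: "\<And>j. j \<in> Basis \<Longrightarrow> c j \<noteq> 0"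
  shows "(\<lambda>x. f (dilation c x)) \<in> borel_measurable lebesgue \<longleftrightarrow> f \<in> borel_measurable lebesgue"
proof
  assume "(\<lambda>x. f (dilation c x)) \<in> borel_measurable lebesgue"
  from measurable_compose[OF dilation_measurable_lebesgue[of "\<lambda>j. 1 / c j"] this]
  show "f \<in> borel_measurable lebesgue" using c by (simp add: dilation_inverse)
qed (rule measurable_compose[OF dilation_measurable_lebesgue[OF c]])

lemma nn_integral_dilation:
  assumes c: "\<And>j. j \<in> Basis \<Longrightarrow> c j \<noteq> 0" and f: "f \<in> borel_measurable lebesgue"
  shows "(\<integral>\<^sup>+x. f x \<partial>lebesgue) = ennreal (\<Prod>j\<in>Basis. \<bar>c j\<bar>) * (\<integral>\<^sup>+x. f (dilation c x) \<partial>lebesgue)"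
proof -
  note [measurable] = f dilation_measurable_lebesgue[OF c]
  have "(\<integral>\<^sup>+x. f x \<partial>lebesgue) =
      (\<integral>\<^sup>+x. f x \<partial>density (distr lebesgue lebesgue (dilation c)) (\<lambda>_. ennreal (\<Prod>j\<in>Basis. \<bar>c j\<bar>)))"
    by (subst lebesgue_eq_dilation[of c]) (use c in auto)
  also have "\<dots> = ennreal (\<Prod>j\<in>Basis. \<bar>c j\<bar>) * (\<integral>\<^sup>+x. f (dilation c x) \<partial>lebesgue)"
    using f by (simp add: nn_integral_density nn_integral_cmult nn_integral_distr)
  finally show ?thesis .
qed

lemma integrable_dilation_iff:
  fixes f :: "'a::euclidean_space \<Rightarrow> 'b::{banach, second_countable_topology}"
  assumes c: "\<And>j. j \<in> Basis \<Longrightarrow> c j \<noteq> 0"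
  shows "integrable lebesgue (\<lambda>x. f (dilation c x)) \<longleftrightarrow> integrable lebesgue f"
proof (cases "f \<in> borel_measurable lebesgue")
  case True
  have "0 < (\<Prod>j\<in>Basis. \<bar>c j\<bar>)" using c by (auto intro!: prod_pos)
  then show ?thesis
    using True c nn_integral_dilation[where c=c and f="\<lambda>x. ennreal (norm (f x))"]
    by (auto simp: integrable_iff_bounded borel_measurable_dilation_iff ennreal_mult_less_top)
next
  case False
  then have "(\<lambda>x. f (dilation c x)) \<notin> borel_measurable lebesgue"
    using borel_measurable_dilation_iff[of c f] c by simp
  with False show ?thesis by (simp add: integrable_iff_bounded)
qed

lemma integral_dilation:
  fixes f :: "'a::euclidean_space \<Rightarrow> 'b::{banach, second_countable_topology}"
  assumes c: "\<And>j. j \<in> Basis \<Longrightarrow> c j \<noteq> 0"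
  shows "(\<integral>x. f x \<partial>lebesgue) = (\<Prod>j\<in>Basis. \<bar>c j\<bar>) *\<^sub>R (\<integral>x. f (dilation c x) \<partial>lebesgue)"
proof (cases "f \<in> borel_measurable lebesgue")
  case True
  note [measurable] = True dilation_measurable_lebesgue[OF c]
  have "(\<integral>x. f x \<partial>lebesgue) =
      (\<integral>x. f x \<partial>density (distr lebesgue lebesgue (dilation c)) (\<lambda>_. ennreal (\<Prod>j\<in>Basis. \<bar>c j\<bar>)))"
    by (subst lebesgue_eq_dilation[of c]) (use c in auto)
  also have "\<dots> = (\<Prod>j\<in>Basis. \<bar>c j\<bar>) *\<^sub>R (\<integral>x. f (dilation c x) \<partial>lebesgue)"
    by (subst integral_density) (auto simp: integral_distr prod_nonneg)
  finally show ?thesis .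
next
  case False
  then have "\<not> integrable lebesgue f" "\<not> integrable lebesgue (\<lambda>x. f (dilation c x))"
    using integrable_dilation_iff[of c f] c by (auto simp: integrable_iff_bounded)
  then show ?thesis by (simp add: not_integrable_integral_eq)
qed

text \<open>
  The basis vectors of \<open>\<real> \<times> 'a\<close> with vanishing space component are the time direction.
\<close>

definition parabolic_weight :: "real \<Rightarrow> real \<times> 'a::euclidean_space \<Rightarrow> real" where
  "parabolic_weight k j = (if snd j = 0 then k\<^sup>2 else k)"

context
  fixes k :: real assumes k: "k > 0"
begin

lemma AE_scaleR: "AE x in lebesgue. P x \<Longrightarrow> AE x in lebesgue. P (k *\<^sub>R x :: 'a::euclidean_space)"
  using AE_dilation[of "\<lambda>_. k" P] k by (simp add: dilation_const)

lemma borel_measurable_scaleR_iff: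
  fixes f :: "'a::euclidean_space \<Rightarrow> 'b::topological_space"
  shows "(\<lambda>x. f (k *\<^sub>R x)) \<in> borel_measurable lebesgue \<longleftrightarrow> f \<in> borel_measurable lebesgue"
  using borel_measurable_dilation_iff[of "\<lambda>_. k" f] k by (simp add: dilation_const)

lemma nn_integral_scaleR:
  fixes f :: "'a::euclidean_space \<Rightarrow> ennreal"
  assumes "f \<in> borel_measurable lebesgue"
  shows "(\<integral>\<^sup>+x. f x \<partial>lebesgue) = ennreal (k ^ DIM('a)) * (\<integral>\<^sup>+x. f (k *\<^sub>R x) \<partial>lebesgue)"
  using nn_integral_dilation[of "\<lambda>_. k" f] k assms by (simp add: dilation_const)

lemma integrable_scaleR_iff:
  fixes f :: "'a::euclidean_space \<Rightarrow> 'b::{banach, second_countable_topology}"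
  shows "integrable lebesgue (\<lambda>x. f (k *\<^sub>R x)) \<longleftrightarrow> integrable lebesgue f"
  using integrable_dilation_iff[of "\<lambda>_. k" f] k by (simp add: dilation_const)

lemma integral_scaleR_arg:
  fixes f :: "'a::euclidean_space \<Rightarrow> 'b::{banach, second_countable_topology}"
  shows "(\<integral>x. f x \<partial>lebesgue) = k ^ DIM('a) *\<^sub>R (\<integral>x. f (k *\<^sub>R x) \<partial>lebesgue)"
  using integral_dilation[of "\<lambda>_. k" f] k by (simp add: dilation_const)

lemma dilation_parabolic:
  "dilation (parabolic_weight k) (\<tau>, y :: 'a::euclidean_space) = (k\<^sup>2 * \<tau>, k *\<^sub>R y)"
proof -
  have "(\<Sum>j\<in>Basis. (k * (y \<bullet> j)) *\<^sub>R j) = k *\<^sub>R y"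
    using dilation_const[of k y] by (simp add: dilation_def)
  then show ?thesis
    unfolding dilation_def Basis_prod_def parabolic_weight_def
    by (subst sum.union_disjoint)
       (auto simp: sum.reindex inj_on_def sum_prod[symmetric] nonzero_Basis prod_eq_iff fst_sum snd_sum cong: sum.cong)
qed

lemma parabolic_weight_nonzero: "parabolic_weight k j \<noteq> 0"
  using k by (auto simp: parabolic_weight_def)

lemma dilation_parabolic': "dilation (parabolic_weight k) z = (k\<^sup>2 * fst z, k *\<^sub>R snd z)"
  using dilation_parabolic[of "fst z" "snd z"] by simp

lemmas borel_measurable_parabolic_iff =
  borel_measurable_dilation_iff[of "parabolic_weight k", OF parabolic_weight_nonzero, unfolded dilation_parabolic']

lemmas integrable_parabolic_iff =
  integrable_dilation_iff[of "parabolic_weight k", OF parabolic_weight_nonzero, unfolded dilation_parabolic']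

end

text \<open>
  Lebesgue measure on a product is only the completion of the product measure, but null sets are
  contained in Borel null sets, to which Tonelli's theorem applies.
\<close>

lemma AE_lebesgue_pairD:
  fixes P :: "('a::euclidean_space \<times> 'b::euclidean_space) \<Rightarrow> bool"
  assumes "AE z in lebesgue. P z"
  shows "AE x in lebesgue. AE y in lebesgue. P (x, y)"
proof -
  have "AE z in lborel \<Otimes>\<^sub>M lborel. P z"
    unfolding lborel_prod using assms by (simp add: AE_completion_iff)
  from lborel_pair.AE_pair[OF this] show ?thesis
    by (simp add: AE_completion_iff)
qed

section \<open>Polynomial weights\<close>

text \<open>
  The exponent is chosen two above the dimension: a measure whose mass on balls of radius \<open>R\<close> grows
  like \<open>R\<^sup>d\<close> then integrates this weight, the shells being controlled by \<open>\<Sum> n\<^sup>-\<^sup>2\<close>.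
\<close>

definition decay :: "'a::euclidean_space \<Rightarrow> real" where
  "decay x = 1 / (1 + norm x) ^ (DIM('a) + 2)"

lemma decay_pos: "0 < decay x"
  by (auto simp: decay_def add_pos_nonneg simp del: power_Suc intro!: divide_pos_pos zero_less_power)

lemma decay_measurable [measurable]: "decay \<in> borel_measurable borel"
  unfolding decay_def[abs_def] by measurable

lemma cball_borel [measurable, simp]: "cball x r \<in> sets borel" for x :: "'a::euclidean_space"
  by (rule borel_closed) simp

text \<open>
  Each point is charged to the first sublevel set \<open>{N \<le> n + 1}\<close> that contains it, where the weight is at
  most \<open>(n + 1)\<close> to the power \<open>-(d + 2)\<close>. The radius \<open>N\<close> is a function on an arbitrary measure space
  because the lemma is used both on space and on space-time, where \<open>N\<close> only sees the space component.
\<close>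

lemma nn_integral_decay_le:
  fixes N :: "'m \<Rightarrow> real" and C :: ennreal
  assumes N [measurable]: "N \<in> borel_measurable M" and N0: "\<And>z. N z \<ge> 0"
    and growth: "\<And>n::nat. emeasure M {z \<in> space M. N z \<le> real n + 1} \<le> ennreal ((real n + 1) ^ d) * C"
  shows "(\<integral>\<^sup>+z. ennreal (1 / (1 + N z) ^ (d + 2)) \<partial>M) \<le> ennreal (\<Sum>n. 1 / (real n + 1)\<^sup>2) * C"
proof -
  define c where "c n = 1 / (real n + 1) ^ (d + 2)" for n :: nat
  define A where "A n = {z \<in> space M. N z \<le> real n + 1}" for n :: nat
  have [measurable]: "A n \<in> sets M" for n unfolding A_def by measurable
  have le: "ennreal (1 / (1 + N z) ^ (d + 2)) \<le> (\<Sum>n. ennreal (c n) * indicator (A n) z)"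
    if z: "z \<in> space M" for z
  proof -
    \<comment> \<open>the least index whose sublevel set contains the point\<close>
    define n where "n = nat (\<lceil>N z\<rceil> - 1)"
    have 1: "N z \<le> real n + 1" "real n \<le> N z"
      unfolding n_def using N0[of z] by linarith+
    have "1 / (1 + N z) ^ (d + 2) \<le> c n"
      unfolding c_def by (intro divide_left_mono power_mono) (use 1 N0[of z] in \<open>auto intro!: mult_pos_pos zero_less_power\<close>)
    then have "ennreal (1 / (1 + N z) ^ (d + 2)) \<le> ennreal (c n) * indicator (A n) z"
      using 1 z by (simp add: A_def ennreal_leI)
    also have "\<dots> = (\<Sum>i\<in>{n}. ennreal (c i) * indicator (A i) z)"
      by (subst sum.insert) auto
    also have "\<dots> \<le> (\<Sum>n. ennreal (c n) * indicator (A n) z)"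
      by (rule sum_le_suminf) auto
    finally show ?thesis .
  qed
  have sum: "summable (\<lambda>n. 1 / (real n + 1)\<^sup>2)"
    using inverse_power_summable[of 2, where 'a=real] summable_Suc_iff[of "\<lambda>n. 1 / (real n)\<^sup>2"]
    by (simp add: inverse_eq_divide add.commute)
  have "(\<integral>\<^sup>+z. ennreal (1 / (1 + N z) ^ (d + 2)) \<partial>M) \<le> (\<integral>\<^sup>+z. (\<Sum>n. ennreal (c n) * indicator (A n) z) \<partial>M)"
    by (intro nn_integral_mono le)
  also have "\<dots> = (\<Sum>n. ennreal (c n) * emeasure M (A n))"
    by (simp add: nn_integral_suminf nn_integral_cmult)
  also have "\<dots> \<le> (\<Sum>n. ennreal (1 / (real n + 1)\<^sup>2) * C)"
  proof (intro suminf_le allI)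
    fix n
    have "ennreal (c n) * emeasure M (A n) \<le> ennreal (c n) * (ennreal ((real n + 1) ^ d) * C)"
      unfolding A_def by (intro mult_left_mono growth) auto
    also have "\<dots> = ennreal (c n * (real n + 1) ^ d) * C"
      by (subst ennreal_mult) (auto simp: c_def mult.assoc)
    also have "c n * (real n + 1) ^ d = 1 / (real n + 1)\<^sup>2"
      unfolding c_def by (simp add: power_add power2_eq_square)
    finally show "ennreal (c n) * emeasure M (A n) \<le> ennreal (1 / (real n + 1)\<^sup>2) * C" .
  qed auto
  also have "\<dots> = ennreal (\<Sum>n. 1 / (real n + 1)\<^sup>2) * C"
    using sum by (simp add: suminf_ennreal2)
  finally show ?thesis .
qed

text \<open>
  Dyadic decomposition: on the annulus between the radii \<open>2\<^sup>-\<^sup>k\<^sup>-\<^sup>1\<close> and \<open>2\<^sup>-\<^sup>k\<close> the singularity costs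
  \<open>2\<close> to the power \<open>(k + 1) \<beta>\<close>, the volume gains \<open>2\<close> to the power \<open>- k d\<close>, and \<open>\<beta> < d\<close> leaves a convergent
  geometric series.
\<close>

lemma nn_integral_norm_powr_cball_finite:
  assumes b: "0 \<le> \<beta>" "\<beta> < real DIM('a::euclidean_space)"
  shows "(\<integral>\<^sup>+x\<in>cball 0 1. ennreal (norm (x::'a) powr (- \<beta>)) \<partial>lborel) < \<infinity>"
proof -
  let ?V = "unit_ball_vol (real DIM('a))"
  define c where "c k = 2 powr (real (Suc k) * \<beta>)" for k :: nat
  define r where "r = (2::real) powr (\<beta> - real DIM('a))"
  have r: "0 \<le> r" "r < 1"
    using b by (auto simp: r_def powr_less_one)
  have le: "ennreal (norm x powr (- \<beta>)) * indicator (cball 0 1) x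
      \<le> (\<Sum>k. ennreal (c k) * indicator (cball 0 ((1/2) ^ k)) x)" for x :: 'a
  proof (cases "x = 0 \<or> norm x > 1")
    case False
    then have x: "0 < norm x" "norm x \<le> 1" by auto
    define k where "k = (LEAST k. (1/2) ^ Suc k < norm x)"
    have "\<exists>k. (1/2::real) ^ k < norm x" using x by (intro real_arch_pow_inv) auto
    then obtain j where "(1/2::real) ^ j < norm x" ..
    then have ex: "(1/2::real) ^ Suc j < norm x"
      by (rule le_less_trans[rotated]) simp
    have k1: "(1/2::real) ^ Suc k < norm x" unfolding k_def by (rule LeastI[of _ j], rule ex)
    have k2: "norm x \<le> (1/2) ^ k"
    proof (cases k)
      case (Suc i)
      then have "\<not> (1/2::real) ^ Suc i < norm x"
        unfolding k_def by (intro not_less_Least) simp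
      then show ?thesis using Suc by simp
    qed (use x in simp)
    have "norm x powr (- \<beta>) \<le> ((1/2) ^ Suc k) powr (- \<beta>)"
      using k1 b x by (intro powr_mono2') auto
    also have "\<dots> = c k"
      unfolding c_def by (simp add: powr_realpow[symmetric] powr_powr powr_minus powr_divide powr_mult del: power_Suc)
    finally have "ennreal (norm x powr (- \<beta>)) * indicator (cball 0 1) x
        \<le> ennreal (c k) * indicator (cball 0 ((1/2) ^ k)) x"
      using k2 x by (simp add: ennreal_leI)
    also have "\<dots> = (\<Sum>i\<in>{k}. ennreal (c i) * indicator (cball 0 ((1/2) ^ i)) x)"
      by (subst sum.insert) auto
    also have "\<dots> \<le> (\<Sum>i. ennreal (c i) * indicator (cball 0 ((1/2) ^ i)) x)"
      by (rule sum_le_suminf) auto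
    finally show ?thesis .
  qed auto
  have "(\<integral>\<^sup>+x\<in>cball 0 1. ennreal (norm (x::'a) powr (- \<beta>)) \<partial>lborel)
      \<le> (\<integral>\<^sup>+x. (\<Sum>k. ennreal (c k) * indicator (cball 0 ((1/2) ^ k)) (x::'a)) \<partial>lborel)"
    by (intro nn_integral_mono le)
  also have "\<dots> = (\<Sum>k. ennreal (c k) * ennreal (?V * ((1/2) ^ k) ^ DIM('a)))"
    by (simp add: nn_integral_suminf nn_integral_cmult emeasure_cball)
  also have "\<dots> = (\<Sum>k. ennreal (2 powr \<beta> * ?V * r ^ k))"
  proof (intro suminf_cong)
    fix k
    have "((1/2::real) ^ k) ^ DIM('a) = 2 powr (- (real k * real DIM('a)))"
      by (simp add: powr_minus powr_realpow[symmetric] powr_powr powr_divide inverse_eq_divide flip: power_mult)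
    moreover have "r ^ k = 2 powr (real k * (\<beta> - real DIM('a)))"
      unfolding r_def by (simp add: powr_realpow[symmetric] powr_powr mult.commute)
    ultimately have "c k * (?V * ((1/2) ^ k) ^ DIM('a)) = 2 powr \<beta> * ?V * r ^ k"
      unfolding c_def by (simp add: powr_add[symmetric] algebra_simps)
    moreover have "ennreal (c k) * ennreal (?V * ((1/2) ^ k) ^ DIM('a))
        = ennreal (c k * (?V * ((1/2) ^ k) ^ DIM('a)))"
      by (rule ennreal_mult[symmetric]) (auto simp: c_def)
    ultimately show "ennreal (c k) * ennreal (?V * ((1/2) ^ k) ^ DIM('a)) = ennreal (2 powr \<beta> * ?V * r ^ k)"
      by (simp only:)
  qed
  also have "\<dots> < \<infinity>"
    using r by (subst suminf_ennreal2) (auto intro!: summable_mult summable_geometric)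
  finally show ?thesis .
qed

text \<open>
  The singularity at the origin is integrable by the previous lemma. Away from the unit ball the power
  is at most \<open>1\<close>, so the mass of balls grows no faster than their volume.
\<close>

lemma nn_integral_norm_powr_decay_finite:
  assumes b: "0 \<le> \<beta>" "\<beta> < real DIM('a::euclidean_space)"
  shows "(\<integral>\<^sup>+x. ennreal (norm (x::'a) powr (- \<beta>) * decay x) \<partial>lborel) < \<infinity>"
proof -
  let ?f = "\<lambda>x::'a. ennreal (norm x powr (- \<beta>))"
  define J where "J = (\<integral>\<^sup>+x\<in>cball 0 1. ?f x \<partial>lborel)"
  define V where "V = unit_ball_vol (real DIM('a))"
  define C where "C = J + ennreal V"
  let ?M = "density lborel ?f"
  have "(\<integral>\<^sup>+x. ennreal (1 / (1 + norm x) ^ (DIM('a) + 2)) \<partial>?M) \<le> ennreal (\<Sum>n. 1 / (real n + 1)\<^sup>2) * C"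
  proof (rule nn_integral_decay_le)
    fix n :: nat
    let ?R = "real n + 1"
    have "emeasure ?M {z \<in> space ?M. norm z \<le> ?R} = (\<integral>\<^sup>+x. ?f x * indicator (cball 0 ?R) x \<partial>lborel)"
      by (subst emeasure_density) (auto intro!: nn_integral_cong split: split_indicator)
    also have "\<dots> \<le> (\<integral>\<^sup>+x. ?f x * indicator (cball 0 1) x + indicator (cball 0 ?R) x \<partial>lborel)"
    proof (intro nn_integral_mono)
      fix x :: 'a
      have "norm x powr (- \<beta>) \<le> 1 powr (- \<beta>)" if "norm x > 1"
        using that b by (intro powr_mono2') auto
      then show "?f x * indicator (cball 0 ?R) x \<le> ?f x * indicator (cball 0 1) x + indicator (cball 0 ?R) x"
        by (auto split: split_indicator simp: not_le)
    qed
    also have "\<dots> = J + ennreal (V * ?R ^ DIM('a))"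
      by (subst nn_integral_add) (auto simp: J_def V_def emeasure_cball)
    also have "\<dots> \<le> ennreal (?R ^ DIM('a)) * C"
    proof -
      have "J = ennreal 1 * J" by simp
      also have "\<dots> \<le> ennreal (?R ^ DIM('a)) * J"
        by (intro mult_right_mono ennreal_leI one_le_power) auto
      finally show ?thesis
        by (simp add: C_def distrib_right ennreal_mult V_def mult.commute add_mono)
    qed
    finally show "emeasure ?M {z \<in> space ?M. norm z \<le> ?R} \<le> ennreal (?R ^ DIM('a)) * C" .
  qed auto
  also have "\<dots> < \<infinity>"
    using nn_integral_norm_powr_cball_finite[OF b] by (simp add: C_def J_def ennreal_mult_less_top)
  finally show ?thesis
    by (subst (asm) nn_integral_density) (auto simp: decay_def ennreal_mult[symmetric])
qed

section \<open>The heat kernel\<close>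

lemma heat_kernel_nonneg: "0 \<le> heat_kernel t x"
  by (simp add: heat_kernel_def)

lemma heat_kernel_measurable [measurable]: "heat_kernel t \<in> borel_measurable borel"
  unfolding heat_kernel_def[abs_def] by measurable

lemma heat_kernel_measurable_pair [measurable (raw)]:
  assumes [measurable]: "f \<in> borel_measurable M" "g \<in> borel_measurable M"
  shows "(\<lambda>x. heat_kernel (f x) (g x :: 'a::euclidean_space)) \<in> borel_measurable M"
  unfolding heat_kernel_def by measurable

lemma heat_kernel_minus: "heat_kernel t (x - y) = heat_kernel t (y - x)"
  by (simp add: heat_kernel_def norm_minus_commute)

lemma heat_kernel_scale:
  assumes "k > 0" "t > 0"
  shows "heat_kernel (k\<^sup>2 * t) (k *\<^sub>R x :: 'a::euclidean_space) = heat_kernel t x / k ^ DIM('a)"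
proof -
  have "(4 * pi * (k\<^sup>2 * t)) powr (- real DIM('a) / 2) = (k\<^sup>2) powr (- real DIM('a) / 2) * (4 * pi * t) powr (- real DIM('a) / 2)"
    using assms by (subst powr_mult[symmetric]) (auto simp: mult_ac)
  also have "(k\<^sup>2) powr (- real DIM('a) / 2) = 1 / k ^ DIM('a)"
    using assms by (simp add: powr_powr powr_minus_divide powr_realpow flip: powr_numeral)
  finally show ?thesis
    using assms by (simp add: heat_kernel_def power_mult_distrib field_simps)
qed

lemma nn_integral_lborel_affine:
  fixes f :: "'a::euclidean_space \<Rightarrow> ennreal"
  assumes [measurable]: "f \<in> borel_measurable borel" and c: "c \<noteq> 0"
  shows "(\<integral>\<^sup>+x. f x \<partial>lborel) = ennreal (\<bar>c\<bar> ^ DIM('a)) * (\<integral>\<^sup>+x. f (t + c *\<^sub>R x) \<partial>lborel)"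
  by (subst lborel_affine[OF c, of t])
     (simp add: nn_integral_density nn_integral_distr nn_integral_cmult)

lemma integral_lborel_affine:
  fixes f :: "'a::euclidean_space \<Rightarrow> 'b::{banach, second_countable_topology}"
  assumes [measurable]: "f \<in> borel_measurable borel" and c: "c \<noteq> 0"
  shows "(\<integral>x. f x \<partial>lborel) = \<bar>c\<bar> ^ DIM('a) *\<^sub>R (\<integral>x. f (t + c *\<^sub>R x) \<partial>lborel)"
  by (subst lborel_affine[OF c, of t])
     (simp add: integral_density integral_distr)

text \<open>
  The Gaussian factorizes over the coordinates.
\<close>

lemma nn_integral_exp_norm2:
  "(\<integral>\<^sup>+x. ennreal (exp (- (norm (x::'a::euclidean_space))\<^sup>2)) \<partial>lborel) = ennreal (sqrt pi ^ DIM('a))"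
proof -
  have one: "(\<integral>\<^sup>+x. ennreal (exp (- x\<^sup>2)) \<partial>lborel) = ennreal (sqrt pi)"
  proof -
    have "(\<lambda>x. exp (- x\<^sup>2) :: real) = (\<lambda>x. sqrt pi * normal_density 0 (1 / sqrt 2) x)"
      by (simp add: normal_density_def fun_eq_iff power_divide real_sqrt_divide)
    moreover have "has_bochner_integral lborel (\<lambda>x. sqrt pi * normal_density 0 (1 / sqrt 2) x) (sqrt pi * 1)"
      by (intro has_bochner_integral_mult_right) (simp add: has_bochner_integral_iff)
    ultimately show ?thesis
      by (subst nn_integral_eq_integral) (auto simp: has_bochner_integral_iff)
  qed
  have "exp (- (norm x)\<^sup>2) = (\<Prod>b\<in>Basis. exp (- (x \<bullet> b)\<^sup>2))" for x :: 'a
    unfolding power2_norm_eq_inner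
    by (subst euclidean_inner) (simp add: exp_sum[symmetric] sum_negf power2_eq_square)
  then have "(\<integral>\<^sup>+x. ennreal (exp (- (norm (x::'a))\<^sup>2)) \<partial>lborel)
      = (\<integral>\<^sup>+x. (\<Prod>b\<in>Basis. ennreal (exp (- ((x::'a) \<bullet> b)\<^sup>2))) \<partial>lborel)"
    by (simp add: prod_ennreal)
  also have "\<dots> = ennreal (sqrt pi ^ DIM('a))"
    by (subst nn_integral_lborel_prod) (simp_all add: one ennreal_power)
  finally show ?thesis .
qed

lemma nn_integral_heat_kernel_1:
  "(\<integral>\<^sup>+x. ennreal (heat_kernel 1 (x::'a::euclidean_space)) \<partial>lborel) = 1"
proof -
  let ?c = "(4 * pi) powr (- real DIM('a) / 2)"
  have "(\<integral>\<^sup>+x. ennreal (heat_kernel 1 (x::'a)) \<partial>lborel) =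
      ennreal (2 ^ DIM('a)) * (\<integral>\<^sup>+x. ennreal (heat_kernel 1 (0 + 2 *\<^sub>R x :: 'a)) \<partial>lborel)"
    by (subst nn_integral_lborel_affine[of _ 2 0]) auto
  also have "(\<integral>\<^sup>+x. ennreal (heat_kernel 1 (0 + 2 *\<^sub>R x :: 'a)) \<partial>lborel) =
      (\<integral>\<^sup>+x. ennreal ?c * ennreal (exp (- (norm (x::'a))\<^sup>2)) \<partial>lborel)"
    by (intro nn_integral_cong) (simp add: heat_kernel_def power_mult_distrib ennreal_mult)
  also have "\<dots> = ennreal (?c * sqrt pi ^ DIM('a))"
    by (simp add: nn_integral_cmult nn_integral_exp_norm2 ennreal_mult)
  also have "ennreal (2 ^ DIM('a)) * \<dots> = ennreal (2 ^ DIM('a) * (?c * sqrt pi ^ DIM('a)))"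
    by (simp add: ennreal_mult)
  also have "2 ^ DIM('a) * (?c * sqrt pi ^ DIM('a)) = 1"
  proof -
    have "2 ^ DIM('a) * sqrt pi ^ DIM('a) = sqrt (4 * pi) ^ DIM('a)"
      by (simp add: real_sqrt_mult power_mult_distrib)
    also have "\<dots> = (4 * pi) powr (real DIM('a) / 2)"
      by (simp add: powr_half_sqrt[symmetric] powr_powr powr_realpow[symmetric])
    also have "\<dots> * ?c = 1"
      by (simp add: powr_add[symmetric])
    finally show ?thesis by (simp add: mult_ac)
  qed
  finally show ?thesis by simp
qed

text \<open>
  Substituting \<open>y = x - \<surd>t z\<close> moves the time dependence from the kernel to the function, which gives
  both bounds that are uniform in \<open>t\<close> and the limit \<open>t \<rightarrow> 0\<close>.
\<close>

lemma nn_integral_heat_kernel_rescale: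
  fixes F :: "'a::euclidean_space \<Rightarrow> ennreal"
  assumes t: "t > 0" and [measurable]: "F \<in> borel_measurable borel"
  shows "(\<integral>\<^sup>+y. ennreal (heat_kernel t (x - y)) * F y \<partial>lborel) =
    (\<integral>\<^sup>+z. ennreal (heat_kernel 1 z) * F (x - sqrt t *\<^sub>R z) \<partial>lborel)"
proof -
  have "heat_kernel t (sqrt t *\<^sub>R z) * sqrt t ^ DIM('a) = heat_kernel 1 (z::'a)" for z
    using heat_kernel_scale[of "sqrt t" 1 z] t by simp
  then show ?thesis
    using t by (subst nn_integral_lborel_affine[of _ "- sqrt t" x])
      (auto simp: nn_integral_cmult[symmetric] mult.assoc[symmetric] ennreal_mult'[symmetric] mult.commute)
qed

lemma integral_heat_kernel_rescale:
  fixes F :: "'a::euclidean_space \<Rightarrow> 'b::{banach, second_countable_topology}"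
  assumes t: "t > 0" and [measurable]: "F \<in> borel_measurable borel"
  shows "(\<integral>y. heat_kernel t (x - y) *\<^sub>R F y \<partial>lborel) =
    (\<integral>z. heat_kernel 1 z *\<^sub>R F (x - sqrt t *\<^sub>R z) \<partial>lborel)"
proof -
  have "heat_kernel t (sqrt t *\<^sub>R z) * sqrt t ^ DIM('a) = heat_kernel 1 (z::'a)" for z
    using heat_kernel_scale[of "sqrt t" 1 z] t by simp
  then show ?thesis
    using t by (subst integral_lborel_affine[of _ "- sqrt t" x])
      (auto simp: integral_scaleR_right[symmetric] mult.commute simp del: integral_scaleR_right)
qed

text \<open>
  Peetre's inequality \<open>1 + \<bar>x\<bar> \<le> (1 + \<bar>x - z\<bar>) (1 + \<bar>z\<bar>)\<close>, raised to a power.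
\<close>

lemma decay_shift: "decay (x - z) \<le> (1 + norm z) ^ (DIM('a) + 2) * decay (x :: 'a::euclidean_space)"
proof -
  have "1 + norm x \<le> 1 + (norm (x - z) + norm z)" using norm_triangle_sub[of x z] by simp
  also have "\<dots> \<le> (1 + norm (x - z)) * (1 + norm z)" by (simp add: algebra_simps)
  finally have "(1 + norm x) ^ (DIM('a) + 2) \<le> ((1 + norm (x - z)) * (1 + norm z)) ^ (DIM('a) + 2)"
    by (rule power_mono) simp
  then show ?thesis
    unfolding decay_def power_mult_distrib
    by (simp add: divide_simps add_pos_nonneg less_imp_neq[symmetric] del: power_add power_Suc) (simp add: mult_ac)
qed

definition gauss_moment :: "'a::euclidean_space itself \<Rightarrow> ennreal" where
  "gauss_moment _ = (\<integral>\<^sup>+z. ennreal (heat_kernel 1 (z::'a) * (1 + norm z) ^ (DIM('a) + 2)) \<partial>lborel)"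

text \<open>
  A Gaussian beats the square of the polynomial: from \<open>1 + r \<le> exp r\<close> and
  \<open>2 m r \<le> r\<^sup>2 / 4 + 4 m\<^sup>2\<close> the integrand is bounded by a multiple of the weight itself.
\<close>

lemma gauss_moment_finite: "gauss_moment TYPE('a::euclidean_space) < \<infinity>"
proof -
  define m where "m = DIM('a) + 2"
  define c where "c = (4 * pi) powr (- real DIM('a) / 2) * exp (4 * (real m)\<^sup>2)"
  have le: "heat_kernel 1 z * (1 + norm z) ^ m \<le> c * decay z" for z :: 'a
  proof -
    have "(1 + norm z) ^ (2 * m) \<le> exp (norm z) ^ (2 * m)"
      by (intro power_mono exp_ge_add_one_self) auto
    also have "\<dots> = exp (2 * real m * norm z)"
      by (simp add: exp_of_nat_mult[symmetric])
    also have "\<dots> \<le> exp ((norm z)\<^sup>2 / 4 + 4 * (real m)\<^sup>2)"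
      using zero_le_power2[of "norm z / 2 - 2 * real m"] by (simp add: power2_diff power_divide power_mult_distrib algebra_simps)
    finally have "(1 + norm z) ^ m * (1 + norm z) ^ m \<le> exp ((norm z)\<^sup>2 / 4) * exp (4 * (real m)\<^sup>2)"
      by (simp add: exp_add mult_2 power_add)
    then have "exp (- (norm z)\<^sup>2 / 4) * (1 + norm z) ^ m \<le> exp (4 * (real m)\<^sup>2) / (1 + norm z) ^ m"
      by (simp add: exp_minus field_simps add_pos_nonneg)
    then have "(4 * pi) powr (- real DIM('a) / 2) * (exp (- (norm z)\<^sup>2 / 4) * (1 + norm z) ^ m)
        \<le> (4 * pi) powr (- real DIM('a) / 2) * (exp (4 * (real m)\<^sup>2) / (1 + norm z) ^ m)"
      by (rule mult_left_mono) simp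
    then show ?thesis
      unfolding c_def decay_def heat_kernel_def m_def[symmetric] by (simp add: mult.assoc)
  qed
  have "gauss_moment TYPE('a) \<le> (\<integral>\<^sup>+z. ennreal c * ennreal (norm (z::'a) powr (-0) * decay z) \<partial>lborel)"
    unfolding gauss_moment_def
  proof (intro nn_integral_mono_AE, use AE_lborel_singleton[of "0::'a"] in eventually_elim)
    case (elim z)
    then show ?case
      using le[of z] by (simp add: m_def ennreal_mult'[symmetric] c_def ennreal_leI)
  qed
  also have "\<dots> < \<infinity>"
    using nn_integral_norm_powr_decay_finite[of 0, where 'a='a]
    by (subst nn_integral_cmult) (auto simp: ennreal_mult_less_top)
  finally show ?thesis .
qed

text \<open>
  The constant with which the heat flow up to time \<open>t\<close> preserves the weight. The factor with the maximum
  bounds \<open>1 + \<surd>t r\<close> by a multiple of \<open>1 + r\<close>.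
\<close>

definition heat_decay_const :: "'a::euclidean_space itself \<Rightarrow> real \<Rightarrow> real" where
  "heat_decay_const T t = max 1 (sqrt t) ^ (DIM('a) + 2) * enn2real (gauss_moment T)"

lemma heat_decay_const_nonneg: "0 \<le> heat_decay_const T t"
  by (simp add: heat_decay_const_def)

lemma heat_decay_const_mono: "t \<le> t' \<Longrightarrow> heat_decay_const T t \<le> heat_decay_const T t'"
  unfolding heat_decay_const_def by (intro mult_right_mono power_mono max.mono) auto

text \<open>
  The heat semigroup preserves polynomial decay, locally uniformly in time. By duality it is this bound
  that makes the pairing of a Duhamel term with a Schwartz function finite.
\<close>

lemma heat_decay_le:
  fixes x :: "'a::euclidean_space"
  assumes t: "t > 0"
  shows "(\<integral>\<^sup>+y. ennreal (heat_kernel t (x - y)) * ennreal (decay y) \<partial>lborel)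
    \<le> ennreal (heat_decay_const TYPE('a) t * decay x)"
proof -
  let ?m = "DIM('a) + 2"
  have "(\<integral>\<^sup>+y. ennreal (heat_kernel t (x - y)) * ennreal (decay y) \<partial>lborel) =
      (\<integral>\<^sup>+z. ennreal (heat_kernel 1 z) * ennreal (decay (x - sqrt t *\<^sub>R z)) \<partial>lborel)"
    by (rule nn_integral_heat_kernel_rescale[OF t]) measurable
  also have "\<dots> \<le> (\<integral>\<^sup>+z. ennreal (max 1 (sqrt t) ^ ?m * decay x) *
      ennreal (heat_kernel 1 (z::'a) * (1 + norm z) ^ ?m) \<partial>lborel)"
  proof (intro nn_integral_mono)
    fix z :: 'a
    have "1 + norm (sqrt t *\<^sub>R z) \<le> max 1 (sqrt t) * (1 + norm z)"
      using t by (simp add: distrib_left add_mono mult_right_mono)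
    then have "(1 + norm (sqrt t *\<^sub>R z)) ^ ?m \<le> (max 1 (sqrt t) * (1 + norm z)) ^ ?m"
      by (intro power_mono) auto
    then have "decay (x - sqrt t *\<^sub>R z) \<le> (max 1 (sqrt t) ^ ?m * (1 + norm z) ^ ?m) * decay x"
      unfolding power_mult_distrib
      by (intro order_trans[OF decay_shift] mult_right_mono) (auto simp: decay_pos less_imp_le)
    from mult_left_mono[OF this heat_kernel_nonneg[of 1 z]]
    have "heat_kernel 1 z * decay (x - sqrt t *\<^sub>R z)
        \<le> max 1 (sqrt t) ^ ?m * decay x * (heat_kernel 1 z * (1 + norm z) ^ ?m)"
      by (simp only: mult_ac)
    then show "ennreal (heat_kernel 1 z) * ennreal (decay (x - sqrt t *\<^sub>R z))
        \<le> ennreal (max 1 (sqrt t) ^ ?m * decay x) * ennreal (heat_kernel 1 z * (1 + norm z) ^ ?m)"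
      using decay_pos[of x] by (simp add: ennreal_mult'[symmetric] heat_kernel_nonneg ennreal_leI)
  qed
  also have "\<dots> = ennreal (max 1 (sqrt t) ^ ?m * decay x) * gauss_moment TYPE('a)"
    unfolding gauss_moment_def by (rule nn_integral_cmult) measurable
  also have "\<dots> = ennreal (heat_decay_const TYPE('a) t * decay x)"
    using gauss_moment_finite[where 'a='a]
    by (cases "gauss_moment TYPE('a)")
      (auto simp: heat_decay_const_def ennreal_mult'[symmetric] decay_pos less_imp_le mult_ac)
  finally show ?thesis .
qed

section \<open>Schwartz functions\<close>

lemma schwartzD:
  assumes "f \<in> schwartz" "bs \<in> lists Basis"
  shows schwartz_differentiable: "iter_pderiv bs f differentiable (at x)"
    and schwartz_bdd: "bdd_above (range (\<lambda>x. (1 + norm x) ^ m * norm (iter_pderiv bs f x)))"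
  using assms by (auto simp: schwartz_def)

lemma schwartz_seminorm_ge:
  assumes "f \<in> schwartz" "bs \<in> lists Basis"
  shows "(1 + norm x) ^ m * norm (iter_pderiv bs f x) \<le> schwartz_seminorm m bs f"
  unfolding schwartz_seminorm_def by (rule cSUP_upper[OF UNIV_I schwartz_bdd[OF assms]])

lemma schwartz_seminorm_nonneg:
  assumes "f \<in> schwartz" "bs \<in> lists Basis"
  shows "0 \<le> schwartz_seminorm m bs f"
  by (rule order_trans[OF _ schwartz_seminorm_ge[OF assms, of 0]]) simp

lemma schwartz_regularity:
  fixes \<psi> :: "'a::euclidean_space \<Rightarrow> 'b::euclidean_space"
  assumes "\<psi> \<in> schwartz"
  shows "continuous_on UNIV \<psi>" "\<psi> \<in> borel_measurable borel"
proof -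
  have "\<psi> differentiable (at x)" for x
    using schwartz_differentiable[OF assms, of "[]" x] by simp
  then show "continuous_on UNIV \<psi>"
    by (simp add: continuous_on_eq_continuous_within differentiable_imp_continuous_within)
  then show "\<psi> \<in> borel_measurable borel" by (rule borel_measurable_continuous_onI)
qed

lemma schwartz_decay:
  fixes \<psi> :: "'a::euclidean_space \<Rightarrow> 'b::real_normed_vector"
  assumes "\<psi> \<in> schwartz"
  shows "norm (\<psi> x) \<le> schwartz_seminorm (DIM('a) + 2) [] \<psi> * decay x"
proof -
  have "0 < (1 + norm x) ^ (DIM('a) + 2)"
    by (intro zero_less_power) (simp add: add_pos_nonneg)
  then show ?thesis
    using schwartz_seminorm_ge[OF assms, of "[]" x "DIM('a) + 2"]
    by (simp add: decay_def field_simps del: power_Suc power_add)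
qed

lemma iter_pderiv_diff:
  assumes f: "f \<in> schwartz" and g: "g \<in> schwartz" and "bs \<in> lists Basis"
  shows "iter_pderiv bs (\<lambda>x. f x - g x) = (\<lambda>x. iter_pderiv bs f x - iter_pderiv bs g x)"
  using assms(3)
proof (induction bs)
  case (Cons b bs)
  then have bs: "bs \<in> lists Basis" and IH: "iter_pderiv bs (\<lambda>x. f x - g x) = (\<lambda>x. iter_pderiv bs f x - iter_pderiv bs g x)"
    by auto
  have "frechet_derivative (\<lambda>x. iter_pderiv bs f x - iter_pderiv bs g x) (at x) =
      (\<lambda>h. frechet_derivative (iter_pderiv bs f) (at x) h - frechet_derivative (iter_pderiv bs g) (at x) h)" for x
    by (rule frechet_derivative_at[symmetric], rule has_derivative_diff)
       (use schwartz_differentiable[OF f bs] schwartz_differentiable[OF g bs] in \<open>simp_all add: frechet_derivative_works[symmetric]\<close>)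
  then show ?case by (simp add: IH)
qed simp

lemma schwartz_diff:
  assumes f: "f \<in> schwartz" and g: "g \<in> schwartz"
  shows "(\<lambda>x. f x - g x) \<in> schwartz"
  unfolding schwartz_def
proof (intro CollectI ballI conjI allI)
  fix bs :: "'a list" and x m assume bs: "bs \<in> lists Basis"
  show "iter_pderiv bs (\<lambda>x. f x - g x) differentiable (at x)"
    unfolding iter_pderiv_diff[OF f g bs]
    by (intro differentiable_diff schwartz_differentiable f g bs)
  show "bdd_above (range (\<lambda>x. (1 + norm x) ^ m * norm (iter_pderiv bs (\<lambda>x. f x - g x) x)))"
  proof (rule bdd_aboveI2)
    fix x
    have "(1 + norm x) ^ m * norm (iter_pderiv bs f x - iter_pderiv bs g x)
        \<le> (1 + norm x) ^ m * (norm (iter_pderiv bs f x) + norm (iter_pderiv bs g x))"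
      by (intro mult_left_mono norm_triangle_ineq4) simp
    also have "\<dots> \<le> schwartz_seminorm m bs f + schwartz_seminorm m bs g"
      unfolding distrib_left by (intro add_mono schwartz_seminorm_ge f g bs)
    finally show "(1 + norm x) ^ m * norm (iter_pderiv bs (\<lambda>x. f x - g x) x)
        \<le> schwartz_seminorm m bs f + schwartz_seminorm m bs g"
      unfolding iter_pderiv_diff[OF f g bs] .
  qed
qed

text \<open>
  Every derivative of \<open>x \<mapsto> f (k x)\<close> produces one factor \<open>k\<close> by the chain rule.
\<close>

lemma iter_pderiv_scale:
  fixes f :: "'a::euclidean_space \<Rightarrow> 'b::real_normed_vector"
  assumes f: "f \<in> schwartz" and "bs \<in> lists Basis"
  shows "iter_pderiv bs (\<lambda>x. f (k *\<^sub>R x)) = (\<lambda>x. k ^ length bs *\<^sub>R iter_pderiv bs f (k *\<^sub>R x))"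
  using assms(2)
proof (induction bs)
  case (Cons b bs)
  then have bs: "bs \<in> lists Basis"
    and IH: "iter_pderiv bs (\<lambda>x. f (k *\<^sub>R x)) = (\<lambda>x. k ^ length bs *\<^sub>R iter_pderiv bs f (k *\<^sub>R x))"
    by auto
  let ?g = "iter_pderiv bs f"
  have der: "(?g has_derivative frechet_derivative ?g (at y)) (at y)" for y
    using schwartz_differentiable[OF f bs] by (simp add: frechet_derivative_works[symmetric])
  have "frechet_derivative (\<lambda>x. k ^ length bs *\<^sub>R ?g (k *\<^sub>R x)) (at x) =
      (\<lambda>h. k ^ length bs *\<^sub>R frechet_derivative ?g (at (k *\<^sub>R x)) (k *\<^sub>R h))" for x
    by (rule frechet_derivative_at[symmetric])
       (intro has_derivative_scaleR_right has_derivative_compose[OF _ der] has_derivative_ident)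
  moreover have "frechet_derivative ?g (at y) (k *\<^sub>R h) = k *\<^sub>R frechet_derivative ?g (at y) h" for y h
    using der[of y] by (simp add: linear_cmul has_derivative_linear)
  ultimately show ?case by (simp add: IH mult.commute)
qed simp

text \<open>
  The seminorm bound gives continuity of the rescaling on the Schwartz space. It is linear in the seminorm
  of \<open>f\<close>, with a constant that does not depend on \<open>f\<close>.
\<close>

lemma schwartz_scale:
  fixes f :: "'a::euclidean_space \<Rightarrow> 'b::real_normed_vector"
  assumes f: "f \<in> schwartz" and k: "k > 0"
  shows "(\<lambda>x. f (k *\<^sub>R x)) \<in> schwartz"
    and "bs \<in> lists Basis \<Longrightarrow> schwartz_seminorm m bs (\<lambda>x. f (k *\<^sub>R x))
      \<le> max 1 (1 / k) ^ m * k ^ length bs * schwartz_seminorm m bs f"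
proof -
  have le: "(1 + norm x) ^ m * norm (iter_pderiv bs (\<lambda>x. f (k *\<^sub>R x)) x)
      \<le> max 1 (1 / k) ^ m * k ^ length bs * schwartz_seminorm m bs f"
    if bs: "bs \<in> lists Basis" for m bs x
  proof -
    have "1 + norm x = 1 + 1 / k * norm (k *\<^sub>R x)" using k by simp
    also have "\<dots> \<le> max 1 (1 / k) * 1 + max 1 (1 / k) * norm (k *\<^sub>R x)"
      by (intro add_mono mult_right_mono) auto
    also have "\<dots> = max 1 (1 / k) * (1 + norm (k *\<^sub>R x))" by (simp only: distrib_left)
    finally have 1: "(1 + norm x) ^ m \<le> max 1 (1 / k) ^ m * (1 + norm (k *\<^sub>R x)) ^ m"
      unfolding power_mult_distrib[symmetric] by (intro power_mono) auto
    have "(1 + norm x) ^ m * norm (iter_pderiv bs (\<lambda>x. f (k *\<^sub>R x)) x) =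
        (1 + norm x) ^ m * (k ^ length bs * norm (iter_pderiv bs f (k *\<^sub>R x)))"
      unfolding iter_pderiv_scale[OF f bs] using k by simp
    also have "\<dots> \<le> (max 1 (1 / k) ^ m * (1 + norm (k *\<^sub>R x)) ^ m) * (k ^ length bs * norm (iter_pderiv bs f (k *\<^sub>R x)))"
      using k by (intro mult_right_mono 1) auto
    also have "\<dots> = (max 1 (1 / k) ^ m * k ^ length bs) * ((1 + norm (k *\<^sub>R x)) ^ m * norm (iter_pderiv bs f (k *\<^sub>R x)))"
      by (simp only: mult_ac)
    also have "\<dots> \<le> (max 1 (1 / k) ^ m * k ^ length bs) * schwartz_seminorm m bs f"
      using k by (intro mult_left_mono schwartz_seminorm_ge f bs) auto
    finally show ?thesis .
  qed
  show "(\<lambda>x. f (k *\<^sub>R x)) \<in> schwartz"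
    unfolding schwartz_def
  proof (intro CollectI ballI conjI allI)
    fix bs :: "'a list" and x m assume bs: "bs \<in> lists Basis"
    show "iter_pderiv bs (\<lambda>x. f (k *\<^sub>R x)) differentiable (at x)"
      unfolding iter_pderiv_scale[OF f bs]
      by (intro differentiable_scaleR differentiable_const
          differentiable_compose[OF schwartz_differentiable[OF f bs]] differentiable_ident)
    show "bdd_above (range (\<lambda>x. (1 + norm x) ^ m * norm (iter_pderiv bs (\<lambda>x. f (k *\<^sub>R x)) x)))"
      by (rule bdd_aboveI2, rule le[OF bs])
  qed
  show "schwartz_seminorm m bs (\<lambda>x. f (k *\<^sub>R x)) \<le> max 1 (1 / k) ^ m * k ^ length bs * schwartz_seminorm m bs f"
    if "bs \<in> lists Basis"
    unfolding schwartz_seminorm_def[of m bs "\<lambda>x. f (k *\<^sub>R x)"]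
    by (rule cSUP_least) (auto intro!: le that)
qed

section \<open>Tempered functions\<close>

text \<open>
  The Bochner integral of a function that is not integrable is \<open>0\<close>.
\<close>

lemma norm_integral_le_nn_integral:
  fixes f :: "'m \<Rightarrow> 'b::{banach, second_countable_topology}"
  shows "ennreal (norm (integral\<^sup>L M f)) \<le> (\<integral>\<^sup>+x. ennreal (norm (f x)) \<partial>M)"
  by (cases "integrable M f") (auto simp: integral_norm_bound_ennreal not_integrable_integral_eq)

text \<open>
  Linearity of the functional comes from linearity of the integral; only convergence of the integrals and
  sequential continuity are left to check.
\<close>

lemma tempered_functionI:
  fixes f :: "'a::euclidean_space \<Rightarrow> 'b::{real_normed_field,euclidean_space}"
  assumes "f \<in> borel_measurable lebesgue"
    and int: "\<And>\<psi>. \<psi> \<in> schwartz \<Longrightarrow> integrable lebesgue (\<lambda>x. f x * \<psi> x)"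
    and cont: "\<And>F \<psi>. (\<And>n::nat. F n \<in> schwartz) \<Longrightarrow> \<psi> \<in> schwartz \<Longrightarrow>
      (\<And>m bs. bs \<in> lists Basis \<Longrightarrow> (\<lambda>n. schwartz_seminorm m bs (\<lambda>x. F n x - \<psi> x)) \<longlonglongrightarrow> 0) \<Longrightarrow>
      (\<lambda>n. regular_dist f (F n)) \<longlonglongrightarrow> regular_dist f \<psi>"
  shows "tempered_function f"
  unfolding tempered_function_def tempered_distribution_def
proof (intro conjI allI ballI impI)
  show "regular_dist f (\<lambda>x. \<psi> x + \<eta> x) = regular_dist f \<psi> + regular_dist f \<eta>"
    if "\<psi> \<in> schwartz" "\<eta> \<in> schwartz" for \<psi> \<eta>
    unfolding regular_dist_def distrib_left by (intro Bochner_Integration.integral_add int that)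
  show "regular_dist f (\<lambda>x. c * \<psi> x) = c * regular_dist f \<psi>" for c \<psi>
  proof -
    have "(\<lambda>x. f x * (c * \<psi> x)) = (\<lambda>x. c * (f x * \<psi> x))"
      by (simp add: fun_eq_iff mult.left_commute)
    then show ?thesis by (simp add: regular_dist_def)
  qed
  show "(\<lambda>n. regular_dist f (F n)) \<longlonglongrightarrow> regular_dist f \<psi>"
    if "\<forall>n. F n \<in> schwartz" "\<psi> \<in> schwartz"
      "\<forall>m. \<forall>bs\<in>lists Basis. (\<lambda>n. schwartz_seminorm m bs (\<lambda>x. F n x - \<psi> x)) \<longlonglongrightarrow> 0" for F \<psi>
    by (rule cont) (use that in auto)
qed (use assms in auto)

lemma tempered_functionD:
  assumes "tempered_function f"
  shows "f \<in> borel_measurable lebesgue"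
    and "\<psi> \<in> schwartz \<Longrightarrow> integrable lebesgue (\<lambda>x. f x * \<psi> x)"
    and "\<And>F. (\<And>n::nat. F n \<in> schwartz) \<Longrightarrow> \<psi> \<in> schwartz \<Longrightarrow>
      (\<And>m bs. bs \<in> lists Basis \<Longrightarrow> (\<lambda>n. schwartz_seminorm m bs (\<lambda>x. F n x - \<psi> x)) \<longlonglongrightarrow> 0) \<Longrightarrow>
      (\<lambda>n. regular_dist f (F n)) \<longlonglongrightarrow> regular_dist f \<psi>"
proof -
  show "f \<in> borel_measurable lebesgue" "\<psi> \<in> schwartz \<Longrightarrow> integrable lebesgue (\<lambda>x. f x * \<psi> x)"
    using assms by (simp_all add: tempered_function_def)
  fix F assume *: "\<And>n::nat. F n \<in> schwartz" "\<psi> \<in> schwartz"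
      "\<And>m bs. bs \<in> lists Basis \<Longrightarrow> (\<lambda>n. schwartz_seminorm m bs (\<lambda>x. F n x - \<psi> x)) \<longlonglongrightarrow> 0"
  have "\<forall>F g. (\<forall>n::nat. F n \<in> schwartz) \<longrightarrow> g \<in> schwartz \<longrightarrow>
      (\<forall>m. \<forall>bs\<in>lists Basis. (\<lambda>n. schwartz_seminorm m bs (\<lambda>x. F n x - g x)) \<longlonglongrightarrow> 0) \<longrightarrow>
      (\<lambda>n. regular_dist f (F n)) \<longlonglongrightarrow> regular_dist f g"
    using assms unfolding tempered_function_def tempered_distribution_def by (elim conjE)
  with * show "(\<lambda>n. regular_dist f (F n)) \<longlonglongrightarrow> regular_dist f \<psi>" by blast
qed

lemma regular_dist_add:
  assumes "tempered_function f" "tempered_function g" "\<psi> \<in> schwartz"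
  shows "regular_dist (\<lambda>x. f x + g x) \<psi> = regular_dist f \<psi> + regular_dist g \<psi>"
  unfolding regular_dist_def distrib_right
  by (intro Bochner_Integration.integral_add tempered_functionD assms)

lemma tempered_function_add:
  assumes f: "tempered_function f" and g: "tempered_function g"
  shows "tempered_function (\<lambda>x. f x + g x)"
proof (rule tempered_functionI)
  show "integrable lebesgue (\<lambda>x. (f x + g x) * \<psi> x)" if "\<psi> \<in> schwartz" for \<psi>
    unfolding distrib_right by (intro Bochner_Integration.integrable_add tempered_functionD f g that)
  show "(\<lambda>n. regular_dist (\<lambda>x. f x + g x) (F n)) \<longlonglongrightarrow> regular_dist (\<lambda>x. f x + g x) \<psi>"
    if "\<And>n::nat. F n \<in> schwartz" "\<psi> \<in> schwartz"
      "\<And>m bs. bs \<in> lists Basis \<Longrightarrow> (\<lambda>n. schwartz_seminorm m bs (\<lambda>x. F n x - \<psi> x)) \<longlonglongrightarrow> 0" for F \<psi>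
    unfolding regular_dist_add[OF f g that(1)] regular_dist_add[OF f g that(2)]
    by (intro tendsto_add tempered_functionD(3)[OF f] tempered_functionD(3)[OF g] that)
qed (intro borel_measurable_add tempered_functionD f g)

text \<open>
  The pairing estimate behind all later bounds: a test function enters only through a multiple of the
  weight that dominates it, so \<open>\<psi>\<close> may be a Schwartz function or its heat flow.
\<close>

lemma regular_dist_weighted:
  fixes f \<psi> :: "'a::euclidean_space \<Rightarrow> 'b::{real_normed_field,euclidean_space}"
  assumes f [measurable]: "f \<in> borel_measurable lebesgue"
    and fin: "(\<integral>\<^sup>+x. ennreal (norm (f x) * decay x) \<partial>lebesgue) < \<infinity>"
    and \<psi> [measurable]: "\<psi> \<in> borel_measurable lebesgue" and le: "\<And>x. norm (\<psi> x) \<le> C * decay x"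
  shows "integrable lebesgue (\<lambda>x. f x * \<psi> x)"
    and "ennreal (norm (regular_dist f \<psi>)) \<le> ennreal C * (\<integral>\<^sup>+x. ennreal (norm (f x) * decay x) \<partial>lebesgue)"
proof -
  have [measurable]: "decay \<in> borel_measurable (lebesgue :: 'a measure)"
    by (rule measurable_completion) simp
  have "0 \<le> C * decay (0::'a)" by (rule order_trans[OF norm_ge_zero le])
  then have C: "0 \<le> C" using decay_pos[of "0::'a"] by (simp add: zero_le_mult_iff)
  have "(\<integral>\<^sup>+x. ennreal (norm (f x * \<psi> x)) \<partial>lebesgue) \<le> (\<integral>\<^sup>+x. ennreal C * ennreal (norm (f x) * decay x) \<partial>lebesgue)"
  proof (intro nn_integral_mono)
    fix x
    have "norm (f x * \<psi> x) \<le> norm (f x) * (C * decay x)"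
      unfolding norm_mult by (intro mult_left_mono le) simp
    then have "norm (f x * \<psi> x) \<le> C * (norm (f x) * decay x)" by (simp add: mult_ac)
    then show "ennreal (norm (f x * \<psi> x)) \<le> ennreal C * ennreal (norm (f x) * decay x)"
      using C by (simp add: ennreal_mult'[symmetric] ennreal_leI)
  qed
  also have "\<dots> = ennreal C * (\<integral>\<^sup>+x. ennreal (norm (f x) * decay x) \<partial>lebesgue)"
    by (rule nn_integral_cmult) measurable
  finally have le': "(\<integral>\<^sup>+x. ennreal (norm (f x * \<psi> x)) \<partial>lebesgue) \<le> \<dots>" .
  then show "ennreal (norm (regular_dist f \<psi>)) \<le> ennreal C * (\<integral>\<^sup>+x. ennreal (norm (f x) * decay x) \<partial>lebesgue)"
    unfolding regular_dist_def by (rule order_trans[OF norm_integral_le_nn_integral])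
  show "integrable lebesgue (\<lambda>x. f x * \<psi> x)"
    using fin by (intro integrableI_bounded le_less_trans[OF le']) (auto simp: ennreal_mult_less_top)
qed

text \<open>
  One seminorm, the one measuring decay of order \<open>d + 2\<close> without derivatives, controls the functional.
\<close>

lemma tempered_function_weighted:
  fixes f :: "'a::euclidean_space \<Rightarrow> 'b::{real_normed_field,euclidean_space}"
  assumes f: "f \<in> borel_measurable lebesgue"
    and fin: "(\<integral>\<^sup>+x. ennreal (norm (f x) * decay x) \<partial>lebesgue) < \<infinity>"
  shows "tempered_function f"
proof (rule tempered_functionI)
  have meas: "\<psi> \<in> borel_measurable lebesgue" if "\<psi> \<in> schwartz" for \<psi> :: "'a \<Rightarrow> 'b"
    using schwartz_regularity(2)[OF that] by (simp add: measurable_completion)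
  show int: "integrable lebesgue (\<lambda>x. f x * \<psi> x)" if "\<psi> \<in> schwartz" for \<psi>
    by (rule regular_dist_weighted(1)[OF f fin meas[OF that] schwartz_decay[OF that]])
  fix F :: "nat \<Rightarrow> 'a \<Rightarrow> 'b" and \<psi>
  assume F: "\<And>n. F n \<in> schwartz" and \<psi>: "\<psi> \<in> schwartz"
    and lim: "\<And>m bs. bs \<in> lists Basis \<Longrightarrow> (\<lambda>n. schwartz_seminorm m bs (\<lambda>x. F n x - \<psi> x)) \<longlonglongrightarrow> 0"
  let ?s = "\<lambda>n. schwartz_seminorm (DIM('a) + 2) [] (\<lambda>x. F n x - \<psi> x)"
  define J where "J = enn2real (\<integral>\<^sup>+x. ennreal (norm (f x) * decay x) \<partial>lebesgue)"
  have "norm (regular_dist f (F n) - regular_dist f \<psi>) \<le> ?s n * J" for n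
  proof -
    have S: "(\<lambda>x. F n x - \<psi> x) \<in> schwartz" by (intro schwartz_diff F \<psi>)
    have "regular_dist f (F n) - regular_dist f \<psi> = regular_dist f (\<lambda>x. F n x - \<psi> x)"
      unfolding regular_dist_def right_diff_distrib
      by (rule Bochner_Integration.integral_diff[symmetric]) (intro int F \<psi>)+
    moreover have "ennreal (norm (regular_dist f (\<lambda>x. F n x - \<psi> x))) \<le> ennreal (?s n) * ennreal J"
      using regular_dist_weighted(2)[OF f fin meas[OF S] schwartz_decay[OF S]] fin
      by (simp add: J_def)
    ultimately show ?thesis
      using schwartz_seminorm_nonneg[OF S, of "[]"]
      by (simp add: ennreal_mult'[symmetric] J_def)
  qed
  moreover have "(\<lambda>n. ?s n * J) \<longlonglongrightarrow> 0"
    by (rule tendsto_mult_left_zero[OF lim]) simp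
  ultimately have "(\<lambda>n. regular_dist f (F n) - regular_dist f \<psi>) \<longlonglongrightarrow> 0"
    by (rule Lim_null_comparison[OF always_eventually[OF allI]])
  then show "(\<lambda>n. regular_dist f (F n)) \<longlonglongrightarrow> regular_dist f \<psi>" by (simp add: LIM_zero_iff)
qed (rule f)

lemma regular_dist_scale:
  fixes f :: "'a::euclidean_space \<Rightarrow> 'b::{real_normed_field,euclidean_space}"
  assumes k: "k > 0"
  shows "regular_dist (\<lambda>x. c *\<^sub>R f (k *\<^sub>R x)) \<psi> = (c / k ^ DIM('a)) *\<^sub>R regular_dist f (\<lambda>x. \<psi> ((1 / k) *\<^sub>R x))"
proof -
  have "regular_dist f (\<lambda>x. \<psi> ((1 / k) *\<^sub>R x)) =
      k ^ DIM('a) *\<^sub>R (\<integral>x. f (k *\<^sub>R x) * \<psi> ((1 / k) *\<^sub>R (k *\<^sub>R x)) \<partial>lebesgue)"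
    unfolding regular_dist_def by (rule integral_scaleR_arg[OF k])
  moreover have "(1 / k) *\<^sub>R (k *\<^sub>R x) = x" for x :: 'a using k by simp
  moreover have "regular_dist (\<lambda>x. c *\<^sub>R f (k *\<^sub>R x)) \<psi> = c *\<^sub>R (\<integral>x. f (k *\<^sub>R x) * \<psi> x \<partial>lebesgue)"
    unfolding regular_dist_def mult_scaleR_left by (rule integral_scaleR_right)
  ultimately show ?thesis using k by (simp only: scaleR_scaleR) simp
qed

text \<open>
  By the substitution \<open>y = k x\<close> the rescaling passes to the test functions, on which it is continuous.
\<close>

lemma tempered_function_scale:
  fixes f :: "'a::euclidean_space \<Rightarrow> 'b::{real_normed_field,euclidean_space}"
  assumes f: "tempered_function f" and k: "k > 0"
  shows "tempered_function (\<lambda>x. c *\<^sub>R f (k *\<^sub>R x))"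
proof (rule tempered_functionI)
  have k': "1 / k > 0" using k by simp
  show "(\<lambda>x. c *\<^sub>R f (k *\<^sub>R x)) \<in> borel_measurable lebesgue"
    using tempered_functionD(1)[OF f] borel_measurable_scaleR_iff[OF k, of f] by measurable
  show "integrable lebesgue (\<lambda>x. c *\<^sub>R f (k *\<^sub>R x) * \<psi> x)" if \<psi>: "\<psi> \<in> schwartz" for \<psi>
  proof -
    have "integrable lebesgue (\<lambda>x. f x * \<psi> ((1 / k) *\<^sub>R x))"
      by (intro tempered_functionD(2)[OF f] schwartz_scale(1) \<psi> k')
    then have "integrable lebesgue (\<lambda>x. f (k *\<^sub>R x) * \<psi> ((1 / k) *\<^sub>R (k *\<^sub>R x)))"
      using integrable_scaleR_iff[OF k, of "\<lambda>x. f x * \<psi> ((1 / k) *\<^sub>R x)"] by simp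
    then show ?thesis using k by simp
  qed
  fix F :: "nat \<Rightarrow> 'a \<Rightarrow> 'b" and \<psi>
  assume F: "\<And>n. F n \<in> schwartz" and \<psi>: "\<psi> \<in> schwartz"
    and lim: "\<And>m bs. bs \<in> lists Basis \<Longrightarrow> (\<lambda>n. schwartz_seminorm m bs (\<lambda>x. F n x - \<psi> x)) \<longlonglongrightarrow> 0"
  show "(\<lambda>n. regular_dist (\<lambda>x. c *\<^sub>R f (k *\<^sub>R x)) (F n)) \<longlonglongrightarrow> regular_dist (\<lambda>x. c *\<^sub>R f (k *\<^sub>R x)) \<psi>"
    unfolding regular_dist_scale[OF k]
  proof (intro tendsto_scaleR tendsto_const tempered_functionD(3)[OF f] schwartz_scale(1) F \<psi> k')
    fix m and bs :: "'a list" assume bs: "bs \<in> lists Basis"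
    let ?G = "\<lambda>n x. F n x - \<psi> x"
    have G: "?G n \<in> schwartz" for n by (intro schwartz_diff F \<psi>)
    have "(\<lambda>n. max 1 (1 / (1 / k)) ^ m * (1 / k) ^ length bs * schwartz_seminorm m bs (?G n)) \<longlonglongrightarrow> 0"
      by (intro tendsto_mult_right_zero lim bs)
    then show "(\<lambda>n. schwartz_seminorm m bs (\<lambda>x. F n ((1 / k) *\<^sub>R x) - \<psi> ((1 / k) *\<^sub>R x))) \<longlonglongrightarrow> 0"
      by (rule tendsto_sandwich[OF always_eventually always_eventually tendsto_const, rotated 2])
         (use schwartz_scale(2)[OF G k' bs] schwartz_seminorm_nonneg[OF schwartz_scale(1)[OF G k'] bs] in auto)
  qed
qed

section \<open>Heat flow of Schwartz functions\<close>

text \<open>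
  Parabolic scaling of the heat semigroup: the factor \<open>k\<^sup>-\<^sup>d\<close> from the kernel cancels the Jacobian of the
  substitution \<open>y \<mapsto> k y\<close>.
\<close>

lemma heat_scale:
  fixes f :: "'a::euclidean_space \<Rightarrow> 'b::{real_normed_field,euclidean_space}"
  assumes k: "k > 0" and t: "t > 0"
  shows "heat t (\<lambda>y. f (k *\<^sub>R y)) x = heat (k\<^sup>2 * t) f (k *\<^sub>R x)"
proof -
  have "heat (k\<^sup>2 * t) f (k *\<^sub>R x) =
      k ^ DIM('a) *\<^sub>R (\<integral>y. heat_kernel (k\<^sup>2 * t) (k *\<^sub>R x - k *\<^sub>R y) *\<^sub>R f (k *\<^sub>R y) \<partial>lebesgue)"
    unfolding heat_def by (rule integral_scaleR_arg[OF k])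
  also have "\<dots> = (\<integral>y. k ^ DIM('a) *\<^sub>R (heat_kernel (k\<^sup>2 * t) (k *\<^sub>R x - k *\<^sub>R y) *\<^sub>R f (k *\<^sub>R y)) \<partial>lebesgue)"
    by (rule integral_scaleR_right[symmetric])
  also have "\<dots> = heat t (\<lambda>y. f (k *\<^sub>R y)) x"
    unfolding heat_def using k
    by (intro Bochner_Integration.integral_cong)
       (simp_all add: heat_kernel_scale[OF k t] flip: scaleR_diff_right)
  finally show ?thesis ..
qed

lemma heat_eq_lborel:
  assumes "\<psi> \<in> borel_measurable borel"
  shows "heat t \<psi> x = (\<integral>y. heat_kernel t (x - y) *\<^sub>R \<psi> y \<partial>lborel)"
  unfolding heat_def using assms by (intro integral_completion) simp

lemma heat_measurable:
  fixes \<psi> :: "'a::euclidean_space \<Rightarrow> 'b::{real_normed_field,euclidean_space}"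
  assumes [measurable]: "\<psi> \<in> borel_measurable borel"
  shows "heat t \<psi> \<in> borel_measurable borel"
proof -
  have "(\<lambda>x. \<integral>y. heat_kernel t (x - y) *\<^sub>R \<psi> y \<partial>lborel) \<in> borel_measurable borel"
    by (rule lborel.borel_measurable_lebesgue_integral) measurable
  then show ?thesis by (simp add: heat_eq_lborel[OF assms, abs_def])
qed

text \<open>
  Inheritance of decay from \<open>\<psi>\<close> by the bound on the heat flow of the weight.
\<close>

lemma heat_schwartz_decay:
  fixes \<psi> :: "'a::euclidean_space \<Rightarrow> 'b::{real_normed_field,euclidean_space}"
  assumes \<psi>: "\<psi> \<in> schwartz" and t: "t > 0"
  shows "norm (heat t \<psi> x) \<le> schwartz_seminorm (DIM('a) + 2) [] \<psi> * heat_decay_const TYPE('a) t * decay x"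
proof -
  let ?S = "schwartz_seminorm (DIM('a) + 2) [] \<psi>"
  have S: "0 \<le> ?S" by (rule schwartz_seminorm_nonneg[OF \<psi>]) simp
  note m = schwartz_regularity(2)[OF \<psi>]
  have "ennreal (norm (heat t \<psi> x)) \<le> (\<integral>\<^sup>+y. ennreal (norm (heat_kernel t (x - y) *\<^sub>R \<psi> y)) \<partial>lborel)"
    unfolding heat_eq_lborel[OF m] by (rule norm_integral_le_nn_integral)
  also have "\<dots> \<le> (\<integral>\<^sup>+y. ennreal ?S * (ennreal (heat_kernel t (x - y)) * ennreal (decay y)) \<partial>lborel)"
  proof (intro nn_integral_mono)
    fix y
    have "norm (heat_kernel t (x - y) *\<^sub>R \<psi> y) \<le> heat_kernel t (x - y) * (?S * decay y)"
      using mult_left_mono[OF schwartz_decay[OF \<psi>, of y] heat_kernel_nonneg[of t "x - y"]]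
      by (simp add: heat_kernel_nonneg)
    then show "ennreal (norm (heat_kernel t (x - y) *\<^sub>R \<psi> y))
        \<le> ennreal ?S * (ennreal (heat_kernel t (x - y)) * ennreal (decay y))"
      using S decay_pos[of y]
      by (simp add: ennreal_mult'[symmetric] heat_kernel_nonneg ennreal_leI mult_ac)
  qed
  also have "\<dots> = ennreal ?S * (\<integral>\<^sup>+y. ennreal (heat_kernel t (x - y)) * ennreal (decay y) \<partial>lborel)"
    by (rule nn_integral_cmult) measurable
  also have "\<dots> \<le> ennreal ?S * ennreal (heat_decay_const TYPE('a) t * decay x)"
    by (intro mult_left_mono heat_decay_le t) simp
  also have "\<dots> = ennreal (?S * heat_decay_const TYPE('a) t * decay x)"
    using S by (simp add: ennreal_mult'[symmetric] mult.assoc)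
  finally show ?thesis
    using S decay_pos[of x] by (simp add: heat_decay_const_nonneg)
qed

lemma integral_heat_kernel_1:
  shows "integrable lborel (heat_kernel 1 :: 'a::euclidean_space \<Rightarrow> real)"
    and "(\<integral>x. heat_kernel 1 (x::'a) \<partial>lborel) = 1"
proof -
  show "integrable lborel (heat_kernel 1 :: 'a \<Rightarrow> real)"
    by (rule integrableI_nonneg) (auto simp: heat_kernel_nonneg nn_integral_heat_kernel_1)
  show "(\<integral>x. heat_kernel 1 (x::'a) \<partial>lborel) = 1"
    by (subst integral_eq_nn_integral) (auto simp: heat_kernel_nonneg nn_integral_heat_kernel_1)
qed

text \<open>
  In the form \<open>\<integral> g\<^sub>1(z) \<psi>(x - \<surd>t z) dz\<close> the limit follows from continuity and boundedness of \<open>\<psi>\<close>.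
\<close>

lemma heat_schwartz_tendsto:
  fixes \<psi> :: "'a::euclidean_space \<Rightarrow> 'b::{real_normed_field,euclidean_space}"
  assumes \<psi>: "\<psi> \<in> schwartz" and X: "X \<longlonglongrightarrow> 0" "\<And>n::nat. X n > 0"
  shows "(\<lambda>n. heat (X n) \<psi> x) \<longlonglongrightarrow> \<psi> x"
proof -
  note [measurable] = schwartz_regularity(2)[OF \<psi>]
  let ?S = "schwartz_seminorm 0 [] \<psi>"
  have le: "norm (\<psi> y) \<le> ?S" for y
    using schwartz_seminorm_ge[OF \<psi>, of "[]" y 0] by simp
  have "(\<lambda>n. \<integral>z. heat_kernel 1 z *\<^sub>R \<psi> (x - sqrt (X n) *\<^sub>R z) \<partial>lborel)
      \<longlonglongrightarrow> (\<integral>z. heat_kernel 1 (z::'a) *\<^sub>R \<psi> x \<partial>lborel)"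
  proof (rule integral_dominated_convergence[where w="\<lambda>z. heat_kernel 1 z * ?S"])
    show "AE z in lborel. (\<lambda>n. heat_kernel 1 z *\<^sub>R \<psi> (x - sqrt (X n) *\<^sub>R z)) \<longlonglongrightarrow> heat_kernel 1 z *\<^sub>R \<psi> x"
    proof (intro always_eventually allI tendsto_scaleR tendsto_const)
      fix z
      have "(\<lambda>n. x - sqrt (X n) *\<^sub>R z) \<longlonglongrightarrow> x - sqrt 0 *\<^sub>R z"
        by (intro tendsto_intros X)
      then show "(\<lambda>n. \<psi> (x - sqrt (X n) *\<^sub>R z)) \<longlonglongrightarrow> \<psi> x"
        by (intro continuous_on_tendsto_compose[OF schwartz_regularity(1)[OF \<psi>]]) auto
    qed
    show "AE z in lborel. norm (heat_kernel 1 z *\<^sub>R \<psi> (x - sqrt (X n) *\<^sub>R z)) \<le> heat_kernel 1 z * ?S" for n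
      by (simp add: heat_kernel_nonneg mult_left_mono le)
  qed (auto intro!: integrable_mult_left integral_heat_kernel_1)
  also have "(\<integral>z. heat_kernel 1 (z::'a) *\<^sub>R \<psi> x \<partial>lborel) = \<psi> x"
    by (subst integral_scaleR_left) (auto simp: integral_heat_kernel_1)
  finally show ?thesis
    using X(2) by (simp add: heat_eq_lborel integral_heat_kernel_rescale)
qed

text \<open>
  The free evolution attains its data in the sense of distributions. Dominated convergence applies since
  the heat flows of \<open>\<psi>\<close> at small times have a common majorant, a multiple of the weight.
\<close>

lemma regular_dist_heat_tendsto:
  fixes f :: "'a::euclidean_space \<Rightarrow> 'b::{real_normed_field,euclidean_space}"
  assumes f [measurable]: "f \<in> borel_measurable lebesgue"
    and fin: "(\<integral>\<^sup>+x. ennreal (norm (f x) * decay x) \<partial>lebesgue) < \<infinity>"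
    and \<psi>: "\<psi> \<in> schwartz"
  shows "((\<lambda>t. regular_dist f (heat t \<psi>)) \<longlongrightarrow> regular_dist f \<psi>) (at_right 0)"
  unfolding tendsto_at_iff_sequentially
proof (intro allI impI, unfold comp_def)
  fix X :: "nat \<Rightarrow> real" assume "\<forall>n. X n \<in> {0<..} - {0}" and lim: "X \<longlonglongrightarrow> 0"
  then have X: "\<And>n. X n > 0" by auto
  obtain B where B: "\<And>n. X n \<le> B"
    using convergent_imp_Bseq[OF convergentI[OF lim]] by (auto simp: Bseq_def abs_le_iff)
  have [measurable]: "\<psi> \<in> borel_measurable lebesgue" "heat t \<psi> \<in> borel_measurable lebesgue" 
    "decay \<in> borel_measurable (lebesgue :: 'a measure)" for t
    using schwartz_regularity(2)[OF \<psi>] heat_measurable[OF schwartz_regularity(2)[OF \<psi>]]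
    by (simp_all add: measurable_completion)
  let ?S = "schwartz_seminorm (DIM('a) + 2) [] \<psi>"
  let ?C = "?S * heat_decay_const TYPE('a) B"
  have S: "0 \<le> ?S" by (rule schwartz_seminorm_nonneg[OF \<psi>]) simp
  show "(\<lambda>n. regular_dist f (heat (X n) \<psi>)) \<longlonglongrightarrow> regular_dist f \<psi>"
    unfolding regular_dist_def
  proof (rule integral_dominated_convergence[where w="\<lambda>x. norm (f x) * decay x * ?C"])
    show "integrable lebesgue (\<lambda>x. norm (f x) * decay x * ?C)"
      using fin decay_pos[where 'a='a]
      by (intro integrable_mult_left integrableI_bounded) (auto simp: less_imp_le norm_mult)
    show "AE x in lebesgue. (\<lambda>n. f x * heat (X n) \<psi> x) \<longlonglongrightarrow> f x * \<psi> x"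
      by (intro always_eventually allI tendsto_mult tendsto_const heat_schwartz_tendsto \<psi> lim X)
    show "AE x in lebesgue. norm (f x * heat (X n) \<psi> x) \<le> norm (f x) * decay x * ?C" for n
    proof (intro always_eventually allI)
      fix x
      have "norm (heat (X n) \<psi> x) \<le> ?S * heat_decay_const TYPE('a) (X n) * decay x"
        by (rule heat_schwartz_decay[OF \<psi> X])
      also have "\<dots> \<le> ?C * decay x"
        using S decay_pos[of x] by (intro mult_right_mono mult_left_mono heat_decay_const_mono B) auto
      finally have "norm (f x) * norm (heat (X n) \<psi> x) \<le> norm (f x) * (?C * decay x)"
        by (rule mult_left_mono) simp
      then show "norm (f x * heat (X n) \<psi> x) \<le> norm (f x) * decay x * ?C"
        by (simp only: norm_mult mult_ac)
    qed
  qed measurable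
qed

section \<open>Invariance of the problem under parabolic rescaling\<close>

text \<open>
  For \<open>\<beta> = (2 + \<gamma>) / (\<alpha> - 1)\<close> this is the scaling \<open>u\<^sub>k\<close> under which the equation is invariant.
\<close>

definition rescale :: "real \<Rightarrow> real \<Rightarrow> (real \<Rightarrow> 'a::real_vector \<Rightarrow> 'b::real_vector) \<Rightarrow> real \<Rightarrow> 'a \<Rightarrow> 'b" where
  "rescale \<beta> k u t x = k powr \<beta> *\<^sub>R u (k\<^sup>2 * t) (k *\<^sub>R x)"

text \<open>
  The free evolution of homogeneous data is self-similar: the dilation is moved to the test function, commuted
  with the heat flow, and absorbed by the homogeneity of \<open>\<phi>\<close>.
\<close>

lemma represents_heat_rescale:
  fixes \<phi> v :: "'a::euclidean_space \<Rightarrow> 'b::{real_normed_field,euclidean_space}"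
  assumes k: "k > 0" and t: "t > 0"
    and \<phi> [measurable]: "\<phi> \<in> borel_measurable lebesgue"
    and hom: "AE x in lebesgue. k powr \<beta> *\<^sub>R \<phi> (k *\<^sub>R x) = \<phi> x"
    and v: "represents v (heat_dist (k\<^sup>2 * t) (regular_dist \<phi>))"
  shows "represents (\<lambda>x. k powr \<beta> *\<^sub>R v (k *\<^sub>R x)) (heat_dist t (regular_dist \<phi>))"
  unfolding represents_def
proof (intro conjI ballI)
  show "tempered_function (\<lambda>x. k powr \<beta> *\<^sub>R v (k *\<^sub>R x))"
    using v k by (intro tempered_function_scale) (auto simp: represents_def)
  fix \<psi> :: "'a \<Rightarrow> 'b" assume \<psi>: "\<psi> \<in> schwartz"
  have k1: "(1 / k) *\<^sub>R (k *\<^sub>R x) = x" "k *\<^sub>R ((1 / k) *\<^sub>R x) = x" for x :: 'a using k by simp_all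
  have flow: "heat (k\<^sup>2 * t) (\<lambda>x. \<psi> ((1 / k) *\<^sub>R x)) x = heat t \<psi> ((1 / k) *\<^sub>R x)" for x
    using heat_scale[OF k t, of "\<lambda>x. \<psi> ((1 / k) *\<^sub>R x)" "(1 / k) *\<^sub>R x"] unfolding k1 by (rule sym)
  have [measurable]: "heat t \<psi> \<in> borel_measurable lebesgue"
    using heat_measurable[OF schwartz_regularity(2)[OF \<psi>]] by (simp add: measurable_completion)
  have [measurable]: "(\<lambda>x. \<phi> (k *\<^sub>R x)) \<in> borel_measurable lebesgue"
    using \<phi> by (simp add: borel_measurable_scaleR_iff[OF k])
  have "regular_dist (\<lambda>x. k powr \<beta> *\<^sub>R v (k *\<^sub>R x)) \<psi>
      = (k powr \<beta> / k ^ DIM('a)) *\<^sub>R regular_dist v (\<lambda>x. \<psi> ((1 / k) *\<^sub>R x))"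
    by (rule regular_dist_scale[OF k])
  also have "regular_dist v (\<lambda>x. \<psi> ((1 / k) *\<^sub>R x)) = regular_dist \<phi> (heat (k\<^sup>2 * t) (\<lambda>x. \<psi> ((1 / k) *\<^sub>R x)))"
    using v schwartz_scale(1)[OF \<psi>, of "1 / k"] k by (simp add: represents_def heat_dist_def)
  also have "heat (k\<^sup>2 * t) (\<lambda>x. \<psi> ((1 / k) *\<^sub>R x)) = (\<lambda>x. heat t \<psi> ((1 / k) *\<^sub>R x))"
    by (rule ext) (rule flow)
  also have "(k powr \<beta> / k ^ DIM('a)) *\<^sub>R regular_dist \<phi> (\<lambda>x. heat t \<psi> ((1 / k) *\<^sub>R x))
      = regular_dist (\<lambda>x. k powr \<beta> *\<^sub>R \<phi> (k *\<^sub>R x)) (heat t \<psi>)"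
    by (rule regular_dist_scale[OF k, symmetric])
  also have "\<dots> = regular_dist \<phi> (heat t \<psi>)"
    unfolding regular_dist_def
  proof (rule integral_cong_AE)
    show "AE x in lebesgue. k powr \<beta> *\<^sub>R \<phi> (k *\<^sub>R x) * heat t \<psi> x = \<phi> x * heat t \<psi> x"
      using hom by eventually_elim (simp only:)
  qed measurable
  finally show "heat_dist t (regular_dist \<phi>) \<psi> = regular_dist (\<lambda>x. k powr \<beta> *\<^sub>R v (k *\<^sub>R x)) \<psi>"
    by (simp add: heat_dist_def)
qed

text \<open>
  For finite \<open>q\<close> this is the substitution \<open>y = k x\<close>; for \<open>q = \<infinity>\<close>, where the power of \<open>k\<close> is \<open>1\<close>, dilations
  preserve null sets.
\<close>

lemma Lq_norm_scale_le:
  fixes g :: "'a::euclidean_space \<Rightarrow> 'b::euclidean_space"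
  assumes k: "k > 0" and c: "c > 0" and q: "1 \<le> q" and g [measurable]: "g \<in> borel_measurable lebesgue"
  shows "Lq_norm q (\<lambda>x. c *\<^sub>R g (k *\<^sub>R x)) \<le> ennreal (c * k powr (- (real DIM('a) * recip q))) * Lq_norm q g"
proof -
  have gk [measurable]: "(\<lambda>x. g (k *\<^sub>R x)) \<in> borel_measurable lebesgue"
    using g by (simp add: borel_measurable_scaleR_iff[OF k])
  show ?thesis
  proof (cases "q = \<infinity>")
    case True
    have "AE x in lebesgue. ennreal (norm (c *\<^sub>R g (k *\<^sub>R x))) \<le> ennreal c * esssup lebesgue (\<lambda>x. ennreal (norm (g x)))"
      using AE_scaleR[OF k esssup_AE[of "\<lambda>x. ennreal (norm (g x))"]]
      by eventually_elim (use c in \<open>simp add: ennreal_mult' mult_left_mono\<close>)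
    then show ?thesis
      using True k c by (auto simp: Lq_norm_def recip_def)
  next
    case False
    define p where "p = enn2real q"
    have p: "p \<ge> 1" "recip q = 1 / p"
      using q False
      by (cases q; simp add: p_def recip_def inverse_ennreal enn2real_eq_0_iff inverse_eq_divide)+
    define I where "I = (\<integral>\<^sup>+x. ennreal (norm (g x) powr p) \<partial>lebesgue)"
    define J where "J = (\<integral>\<^sup>+x. ennreal (norm (g (k *\<^sub>R x)) powr p) \<partial>lebesgue)"
    have IJ: "I = ennreal (k ^ DIM('a)) * J"
      unfolding I_def J_def by (rule nn_integral_scaleR[OF k]) measurable
    have I': "(\<integral>\<^sup>+x. ennreal (norm (c *\<^sub>R g (k *\<^sub>R x)) powr p) \<partial>lebesgue) = ennreal (c powr p) * J"
      unfolding J_def using c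
      by (subst nn_integral_cmult[symmetric]) (auto simp: powr_mult ennreal_mult')
    show ?thesis
    proof (cases "J = \<infinity>")
      case True
      then have "I = \<infinity>" using k by (simp add: IJ ennreal_mult_top)
      then have "Lq_norm q g = \<infinity>" using False by (simp add: Lq_norm_def I_def p_def)
      then show ?thesis using c k by (simp add: ennreal_mult_top)
    next
      case J: False
      then obtain j where j: "J = ennreal j" "j \<ge> 0" by (cases J) auto
      have "I = ennreal (k ^ DIM('a) * j)" using k j by (simp add: IJ ennreal_mult')
      then have "Lq_norm q g = ennreal ((k ^ DIM('a) * j) powr (1 / p))"
        using False j k by (simp add: Lq_norm_def I_def p_def[symmetric] p(2))
      moreover have "Lq_norm q (\<lambda>x. c *\<^sub>R g (k *\<^sub>R x)) = ennreal ((c powr p * j) powr (1 / p))"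
        using False j I' by (simp add: Lq_norm_def p_def[symmetric] p(2) ennreal_mult'[symmetric])
      moreover have "(c powr p * j) powr (1 / p) = c * k powr (- (real DIM('a) / p)) * ((k ^ DIM('a) * j) powr (1 / p))"
      proof -
        have "(k ^ DIM('a)) powr (1 / p) = k powr (real DIM('a) / p)"
          using k by (simp add: powr_realpow[symmetric] powr_powr)
        moreover have "k powr (- (real DIM('a) / p)) * k powr (real DIM('a) / p) = 1"
          using k by (simp add: powr_add[symmetric])
        ultimately show ?thesis
          using j(2) c k p(1) by (simp add: powr_mult powr_powr mult.assoc[symmetric])
      qed
      ultimately show ?thesis using c by (simp add: ennreal_mult'[symmetric] p(2))
    qed
  qed
qed

lemma wLq_norm_scale_le:
  fixes f :: "'a::euclidean_space \<Rightarrow> 'b::euclidean_space"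
  assumes k: "k > 0" and q: "1 \<le> q" and f [measurable]: "f \<in> borel_measurable lebesgue"
  shows "wLq_norm q s (\<lambda>x. k powr \<beta> *\<^sub>R f (k *\<^sub>R x))
    \<le> ennreal (k powr (\<beta> - s - real DIM('a) * recip q)) * wLq_norm q s f"
proof -
  have [measurable]: "(\<lambda>x::'a. norm x powr s) \<in> borel_measurable lebesgue"
    by (rule measurable_completion) measurable
  have "norm x powr s *\<^sub>R k powr \<beta> *\<^sub>R f (k *\<^sub>R x) =
      k powr (\<beta> - s) *\<^sub>R (norm (k *\<^sub>R x) powr s *\<^sub>R f (k *\<^sub>R x))" for x
    using k by (simp add: powr_mult powr_diff)
  then have "wLq_norm q s (\<lambda>x. k powr \<beta> *\<^sub>R f (k *\<^sub>R x)) =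
      Lq_norm q (\<lambda>x. k powr (\<beta> - s) *\<^sub>R (norm (k *\<^sub>R x) powr s *\<^sub>R f (k *\<^sub>R x)))"
    unfolding wLq_norm_def by (simp only:)
  also have "\<dots> \<le> ennreal (k powr (\<beta> - s) * k powr (- (real DIM('a) * recip q))) * wLq_norm q s f"
    unfolding wLq_norm_def
    by (rule Lq_norm_scale_le[OF k _ q, of _ "\<lambda>x. norm x powr s *\<^sub>R f x"]) (use k in auto)
  finally show ?thesis by (simp add: powr_add[symmetric])
qed

lemma open_halfspace_time: "open ({0::real<..} \<times> (UNIV :: 'a::euclidean_space set))"
  by (intro open_Times) auto

text \<open>
  Extension by zero to negative times replaces the restricted measure by Lebesgue measure on space-time,
  where the substitution rules for dilations are available.
\<close>

lemma spacetime_measurable_iff: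
  fixes u :: "real \<Rightarrow> 'a::euclidean_space \<Rightarrow> 'b::euclidean_space"
  shows "(\<lambda>(t, x). u t x) \<in> borel_measurable (lebesgue_on ({0<..} \<times> UNIV)) \<longleftrightarrow>
    (\<lambda>z. indicator {0<..} (fst z) *\<^sub>R u (fst z) (snd z)) \<in> borel_measurable lebesgue"
proof -
  have "{0::real<..} \<times> (UNIV :: 'a set) \<inter> space lebesgue \<in> sets lebesgue"
    using borel_open[OF open_halfspace_time] by (auto intro!: sets_completionI_sets)
  then show ?thesis
    by (subst borel_measurable_restrict_space_iff)
       (auto simp: case_prod_unfold indicator_times intro!: arg_cong[where f="\<lambda>f. f \<in> _"])
qed

lemma spacetime_measurable_rescale:
  fixes u :: "real \<Rightarrow> 'a::euclidean_space \<Rightarrow> 'b::euclidean_space"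
  assumes k: "k > 0" and u: "(\<lambda>(t, x). u t x) \<in> borel_measurable (lebesgue_on ({0<..} \<times> UNIV))"
  shows "(\<lambda>(t, x). rescale \<beta> k u t x) \<in> borel_measurable (lebesgue_on ({0<..} \<times> UNIV))"
proof -
  let ?G = "\<lambda>z. indicator {0<..} (fst z) *\<^sub>R u (fst z) (snd z)"
  have "?G \<in> borel_measurable lebesgue" using u by (simp add: spacetime_measurable_iff)
  then have "(\<lambda>z. ?G (k\<^sup>2 * fst z, k *\<^sub>R snd z)) \<in> borel_measurable lebesgue"
    by (subst borel_measurable_parabolic_iff[OF k])
  then have "(\<lambda>z. k powr \<beta> *\<^sub>R ?G (k\<^sup>2 * fst z, k *\<^sub>R snd z)) \<in> borel_measurable lebesgue"
    by measurable
  moreover have "k powr \<beta> *\<^sub>R ?G (k\<^sup>2 * fst z, k *\<^sub>R snd z) =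
      indicator {0<..} (fst z) *\<^sub>R rescale \<beta> k u (fst z) (snd z)" for z :: "real \<times> 'a"
    using k by (cases "0 < fst z") (simp_all add: rescale_def zero_less_mult_iff)
  ultimately show ?thesis
    unfolding spacetime_measurable_iff by (simp only:)
qed

text \<open>
  The weight in time is the one for which the powers of \<open>k\<close> cancel: the space norm contributes
  the exponent \<open>\<beta> - s - d / q\<close>, which is \<open>s\<^sub>c - s\<close>, and the substitution \<open>t \<mapsto> k\<^sup>2 t\<close> takes it back.
\<close>

lemma rescale_Ks:
  fixes u :: "real \<Rightarrow> 'a::euclidean_space \<Rightarrow> 'b::{real_normed_field,euclidean_space}"
  assumes k: "k > 0" and q: "1 \<le> q" and u: "u \<in> Ks \<gamma> \<alpha> q s"
  defines "\<beta> \<equiv> (2 + \<gamma>) / (\<alpha> - 1)"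
  shows "Ks_norm \<gamma> \<alpha> q s (rescale \<beta> k u) \<le> Ks_norm \<gamma> \<alpha> q s u"
    and "rescale \<beta> k u \<in> Ks \<gamma> \<alpha> q s"
proof -
  have meas: "u t \<in> borel_measurable lebesgue" if "t > 0" for t
    using u that by (auto simp: Ks_def)
  let ?e = "(crit_s DIM('a) \<gamma> \<alpha> q - s) / 2"
  show le: "Ks_norm \<gamma> \<alpha> q s (rescale \<beta> k u) \<le> Ks_norm \<gamma> \<alpha> q s u"
    unfolding Ks_norm_def[of _ _ _ _ "rescale \<beta> k u"]
  proof (rule SUP_least)
    fix t :: real assume "t \<in> {0<..}"
    then have t: "t > 0" by simp
    then have kt: "k\<^sup>2 * t > 0" using k by simp
    have "ennreal (t powr ?e) * wLq_norm q s (rescale \<beta> k u t)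
        \<le> ennreal (t powr ?e) * (ennreal (k powr (\<beta> - s - real DIM('a) * recip q)) * wLq_norm q s (u (k\<^sup>2 * t)))"
      unfolding rescale_def[abs_def] by (intro mult_left_mono wLq_norm_scale_le k q meas kt) simp
    also have "\<dots> = ennreal ((k\<^sup>2 * t) powr ?e) * wLq_norm q s (u (k\<^sup>2 * t))"
    proof -
      have "(k\<^sup>2 * t) powr ?e = (k powr 2) powr ?e * t powr ?e"
        using k t by (simp add: powr_mult)
      also have "(k powr 2) powr ?e = k powr (\<beta> - s - real DIM('a) * recip q)"
      proof -
        have "2 * ?e = \<beta> - s - real DIM('a) * recip q" by (simp add: crit_s_def \<beta>_def)
        then show ?thesis by (simp only: powr_powr)
      qed
      finally show ?thesis by (simp add: ennreal_mult' mult_ac)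
    qed
    also have "\<dots> \<le> Ks_norm \<gamma> \<alpha> q s u"
      unfolding Ks_norm_def using kt by (intro SUP_upper) simp
    finally show "ennreal (t powr ?e) * wLq_norm q s (rescale \<beta> k u t) \<le> Ks_norm \<gamma> \<alpha> q s u" .
  qed
  have "rescale \<beta> k u t \<in> borel_measurable lebesgue" if t: "t > 0" for t
  proof -
    have "(\<lambda>x. u (k\<^sup>2 * t) (k *\<^sub>R x)) \<in> borel_measurable lebesgue"
      using meas[of "k\<^sup>2 * t"] t k by (simp add: borel_measurable_scaleR_iff[OF k])
    then show ?thesis unfolding rescale_def[abs_def] by measurable
  qed
  moreover have "Ks_norm \<gamma> \<alpha> q s (rescale \<beta> k u) < \<infinity>"
    using u by (intro le_less_trans[OF le]) (simp add: Ks_def)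
  ultimately show "rescale \<beta> k u \<in> Ks \<gamma> \<alpha> q s"
    using u spacetime_measurable_rescale[OF k, of u \<beta>] by (simp add: Ks_def)
qed

text \<open>
  The exponent is \<open>\<beta> \<alpha> - \<gamma>\<close>, and it equals \<open>\<beta> + 2\<close> precisely because \<open>\<beta> (\<alpha> - 1) = 2 + \<gamma>\<close>.
\<close>

lemma nonlin_rescale:
  fixes u :: "real \<Rightarrow> 'a::euclidean_space \<Rightarrow> 'b::real_normed_vector"
  assumes k: "k > 0" and \<beta>: "\<beta> * (\<alpha> - 1) = 2 + \<gamma>"
  shows "nonlin \<gamma> \<alpha> (rescale \<beta> k u \<tau>) y = k powr (\<beta> + 2) *\<^sub>R nonlin \<gamma> \<alpha> (u (k\<^sup>2 * \<tau>)) (k *\<^sub>R y)"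
proof -
  have "(k powr \<beta>) powr (\<alpha> - 1) * k powr \<beta> = k powr (\<beta> + 2) * k powr \<gamma>"
    using k \<beta> by (simp add: powr_powr powr_add[symmetric] add_ac)
  then show ?thesis
    using k by (simp add: nonlin_def rescale_def powr_mult mult_ac)
qed

lemma heat_scaleR:
  fixes f :: "'a::euclidean_space \<Rightarrow> 'b::{real_normed_field,euclidean_space}"
  shows "heat t (\<lambda>y. c *\<^sub>R f y) x = c *\<^sub>R heat t f x"
  unfolding heat_def scaleR_left_commute[of _ c] by (rule integral_scaleR_right)

text \<open>
  In the Duhamel term the nonlinearity contributes the exponent \<open>\<beta> + 2\<close>; the substitution in time takes
  away the \<open>2\<close>, and the space integral is invariant by scaling of the heat semigroup. What is left is the
  factor with exponent \<open>\<beta>\<close> that also appears in front of the free part and of the solution.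
\<close>

lemma solution_rescale:
  fixes \<phi> :: "'a::euclidean_space \<Rightarrow> 'b::{real_normed_field,euclidean_space}"
  assumes k: "k > 0" and \<beta>: "\<beta> * (\<alpha> - 1) = 2 + \<gamma>"
    and \<phi>: "\<phi> \<in> borel_measurable lebesgue"
    and hom: "AE x in lebesgue. k powr \<beta> *\<^sub>R \<phi> (k *\<^sub>R x) = \<phi> x"
    and u: "solution \<gamma> \<alpha> (regular_dist \<phi>) u"
  shows "solution \<gamma> \<alpha> (regular_dist \<phi>) (rescale \<beta> k u)"
  unfolding solution_def
proof (intro conjI allI impI)
  show "(\<lambda>(t, x). rescale \<beta> k u t x) \<in> borel_measurable (lebesgue_on ({0<..} \<times> UNIV))"
    using u by (intro spacetime_measurable_rescale k) (simp add: solution_def)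
  fix t :: real assume t: "t > 0"
  have k2: "k\<^sup>2 > 0" and kt: "k\<^sup>2 * t > 0" using k t by auto
  from u kt obtain v where v: "represents v (heat_dist (k\<^sup>2 * t) (regular_dist \<phi>))"
    and eq: "AE x in lebesgue.
           set_integrable lebesgue ({0<..<k\<^sup>2 * t} \<times> UNIV)
             (\<lambda>(\<tau>, y). heat_kernel (k\<^sup>2 * t - \<tau>) (x - y) *\<^sub>R nonlin \<gamma> \<alpha> (u \<tau>) y) \<and>
           u (k\<^sup>2 * t) x = v x +
             set_lebesgue_integral lebesgue {0<..<k\<^sup>2 * t} (\<lambda>\<tau>. heat (k\<^sup>2 * t - \<tau>) (nonlin \<gamma> \<alpha> (u \<tau>)) x)"
    unfolding solution_def by blast
  have ind: "indicator {0<..<k\<^sup>2 * t} (k\<^sup>2 * \<tau>) = (indicator {0<..<t} \<tau> :: real)" for \<tau>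
    using k2 by (simp add: indicator_def zero_less_mult_iff)
  have minus: "k\<^sup>2 * t - k\<^sup>2 * \<tau> = k\<^sup>2 * (t - \<tau>)" for \<tau> by (simp add: right_diff_distrib)
  show "\<exists>w. represents w (heat_dist t (regular_dist \<phi>)) \<and>
        (AE x in lebesgue.
           set_integrable lebesgue ({0<..<t} \<times> UNIV)
             (\<lambda>(\<tau>, y). heat_kernel (t - \<tau>) (x - y) *\<^sub>R nonlin \<gamma> \<alpha> (rescale \<beta> k u \<tau>) y) \<and>
           rescale \<beta> k u t x = w x +
             set_lebesgue_integral lebesgue {0<..<t} (\<lambda>\<tau>. heat (t - \<tau>) (nonlin \<gamma> \<alpha> (rescale \<beta> k u \<tau>)) x))"
  proof (intro exI conjI)
    show "represents (\<lambda>x. k powr \<beta> *\<^sub>R v (k *\<^sub>R x)) (heat_dist t (regular_dist \<phi>))"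
      by (rule represents_heat_rescale[OF k t \<phi> hom v])
    show "AE x in lebesgue.
           set_integrable lebesgue ({0<..<t} \<times> UNIV)
             (\<lambda>(\<tau>, y). heat_kernel (t - \<tau>) (x - y) *\<^sub>R nonlin \<gamma> \<alpha> (rescale \<beta> k u \<tau>) y) \<and>
           rescale \<beta> k u t x = k powr \<beta> *\<^sub>R v (k *\<^sub>R x) +
             set_lebesgue_integral lebesgue {0<..<t} (\<lambda>\<tau>. heat (t - \<tau>) (nonlin \<gamma> \<alpha> (rescale \<beta> k u \<tau>)) x)"
      using AE_scaleR[OF k eq]
    proof (rule eventually_mono, elim conjE, intro conjI)
      fix x
      let ?G = "\<lambda>z. indicator ({0<..<k\<^sup>2 * t} \<times> UNIV) z *\<^sub>R
        (case z of (\<tau>, y) \<Rightarrow> heat_kernel (k\<^sup>2 * t - \<tau>) (k *\<^sub>R x - y) *\<^sub>R nonlin \<gamma> \<alpha> (u \<tau>) y)"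
      assume "set_integrable lebesgue ({0<..<k\<^sup>2 * t} \<times> UNIV)
             (\<lambda>(\<tau>, y). heat_kernel (k\<^sup>2 * t - \<tau>) (k *\<^sub>R x - y) *\<^sub>R nonlin \<gamma> \<alpha> (u \<tau>) y)"
      then have "integrable lebesgue (\<lambda>z. ?G (k\<^sup>2 * fst z, k *\<^sub>R snd z))"
        by (subst integrable_parabolic_iff[OF k, of ?G]) (simp add: set_integrable_def)
      then have "integrable lebesgue (\<lambda>z. (k powr (\<beta> + 2) * k ^ DIM('a)) *\<^sub>R ?G (k\<^sup>2 * fst z, k *\<^sub>R snd z))"
        by (rule integrable_scaleR_right)
      moreover have "(k powr (\<beta> + 2) * k ^ DIM('a)) *\<^sub>R ?G (k\<^sup>2 * fst z, k *\<^sub>R snd z) =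
          indicator ({0<..<t} \<times> UNIV) z *\<^sub>R (case z of (\<tau>, y) \<Rightarrow>
            heat_kernel (t - \<tau>) (x - y) *\<^sub>R nonlin \<gamma> \<alpha> (rescale \<beta> k u \<tau>) y)" for z :: "real \<times> 'a"
      proof (cases z)
        case (Pair \<tau> y)
        show ?thesis
        proof (cases "\<tau> \<in> {0<..<t}")
          case True
          then have "heat_kernel (k\<^sup>2 * (t - \<tau>)) (k *\<^sub>R x - k *\<^sub>R y) = heat_kernel (t - \<tau>) (x - y) / k ^ DIM('a)"
            using heat_kernel_scale[OF k, of "t - \<tau>" "x - y"] by (simp add: scaleR_diff_right)
          then show ?thesis
            using k True by (simp add: Pair indicator_times ind minus nonlin_rescale[OF k \<beta>])
        qed (simp add: Pair indicator_times ind)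
      qed
      ultimately show "set_integrable lebesgue ({0<..<t} \<times> UNIV)
             (\<lambda>(\<tau>, y). heat_kernel (t - \<tau>) (x - y) *\<^sub>R nonlin \<gamma> \<alpha> (rescale \<beta> k u \<tau>) y)"
        by (simp add: set_integrable_def)
      let ?H = "\<lambda>\<tau>. indicator {0<..<k\<^sup>2 * t} \<tau> *\<^sub>R heat (k\<^sup>2 * t - \<tau>) (nonlin \<gamma> \<alpha> (u \<tau>)) (k *\<^sub>R x)"
      assume ux: "u (k\<^sup>2 * t) (k *\<^sub>R x) = v (k *\<^sub>R x) +
             set_lebesgue_integral lebesgue {0<..<k\<^sup>2 * t} (\<lambda>\<tau>. heat (k\<^sup>2 * t - \<tau>) (nonlin \<gamma> \<alpha> (u \<tau>)) (k *\<^sub>R x))"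
      have H: "indicator {0<..<t} \<tau> *\<^sub>R heat (t - \<tau>) (nonlin \<gamma> \<alpha> (rescale \<beta> k u \<tau>)) x =
          k powr (\<beta> + 2) *\<^sub>R ?H (k\<^sup>2 *\<^sub>R \<tau>)" for \<tau>
      proof (cases "\<tau> \<in> {0<..<t}")
        case True
        have "heat (t - \<tau>) (nonlin \<gamma> \<alpha> (rescale \<beta> k u \<tau>)) x =
            k powr (\<beta> + 2) *\<^sub>R heat (t - \<tau>) (\<lambda>y. nonlin \<gamma> \<alpha> (u (k\<^sup>2 * \<tau>)) (k *\<^sub>R y)) x"
          unfolding heat_scaleR[symmetric] by (simp add: nonlin_rescale[OF k \<beta>, abs_def])
        also have "heat (t - \<tau>) (\<lambda>y. nonlin \<gamma> \<alpha> (u (k\<^sup>2 * \<tau>)) (k *\<^sub>R y)) x =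
            heat (k\<^sup>2 * (t - \<tau>)) (nonlin \<gamma> \<alpha> (u (k\<^sup>2 * \<tau>))) (k *\<^sub>R x)"
          using True by (intro heat_scale k) simp
        finally show ?thesis using True by (simp add: ind minus)
      qed (simp add: ind)
      have "set_lebesgue_integral lebesgue {0<..<t} (\<lambda>\<tau>. heat (t - \<tau>) (nonlin \<gamma> \<alpha> (rescale \<beta> k u \<tau>)) x) =
          k powr (\<beta> + 2) *\<^sub>R (\<integral>\<tau>. ?H (k\<^sup>2 *\<^sub>R \<tau>) \<partial>lebesgue)"
        unfolding set_lebesgue_integral_def H by (rule integral_scaleR_right)
      also have "\<dots> = k powr \<beta> *\<^sub>R (k\<^sup>2 *\<^sub>R (\<integral>\<tau>. ?H (k\<^sup>2 *\<^sub>R \<tau>) \<partial>lebesgue))"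
        using k by (simp add: powr_add)
      also have "k\<^sup>2 *\<^sub>R (\<integral>\<tau>. ?H (k\<^sup>2 *\<^sub>R \<tau>) \<partial>lebesgue) = (\<integral>\<tau>. ?H \<tau> \<partial>lebesgue)"
        using integral_scaleR_arg[OF k2, of ?H] by simp
      finally show "rescale \<beta> k u t x = k powr \<beta> *\<^sub>R v (k *\<^sub>R x) +
             set_lebesgue_integral lebesgue {0<..<t} (\<lambda>\<tau>. heat (t - \<tau>) (nonlin \<gamma> \<alpha> (rescale \<beta> k u \<tau>)) x)"
        by (simp add: rescale_def[of \<beta> k u t x] ux scaleR_add_right set_lebesgue_integral_def)
    qed
  qed
qed

section \<open>The nonlinear source of a self-similar solution\<close>

lemma fst_borel [measurable (raw)]:
  fixes f :: "'m \<Rightarrow> 'a::second_countable_topology \<times> 'b::second_countable_topology"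
  assumes "f \<in> borel_measurable M" shows "(\<lambda>x. fst (f x)) \<in> borel_measurable M"
  using assms unfolding borel_prod[symmetric] by measurable

lemma snd_borel [measurable (raw)]:
  fixes f :: "'m \<Rightarrow> 'a::second_countable_topology \<times> 'b::second_countable_topology"
  assumes "f \<in> borel_measurable M" shows "(\<lambda>x. snd (f x)) \<in> borel_measurable M"
  using assms unfolding borel_prod[symmetric] by measurable

declare borel_Times [measurable]

lemma AE_lebesgue_ex:
  assumes "AE x in (lebesgue :: 'a::euclidean_space measure). P x"
  obtains x where "P x"
proof -
  have "emeasure lebesgue (space lebesgue :: 'a set) \<noteq> 0" by (simp add: emeasure_lborel_UNIV)
  then have "ae_filter (lebesgue :: 'a measure) \<noteq> bot" by (simp only: ae_filter_eq_bot_iff not_False_eq_True)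
  from eventually_happens'[OF this assms] show thesis using that by blast
qed

lemma nonlin_spacetime_measurable:
  fixes u :: "real \<Rightarrow> 'a::euclidean_space \<Rightarrow> 'b::euclidean_space"
  assumes "(\<lambda>(t, x). u t x) \<in> borel_measurable (lebesgue_on ({0<..} \<times> UNIV))"
  shows "(\<lambda>z. ennreal (indicator {0<..} (fst z) * norm (nonlin \<gamma> \<alpha> (u (fst z)) (snd z)))) \<in> borel_measurable lebesgue"
proof -
  define w where "w z = indicator {0<..} (fst z) *\<^sub>R u (fst z) (snd z)" for z
  have [measurable]: "w \<in> borel_measurable lebesgue"
    using assms unfolding spacetime_measurable_iff w_def[abs_def] .
  have [measurable]: "(\<lambda>z::real \<times> 'a. norm (snd z) powr \<gamma>) \<in> borel_measurable lebesgue"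
    by (rule measurable_completion) measurable
  have "(\<lambda>z. ennreal (norm (snd z) powr \<gamma> * norm (w z) powr (\<alpha> - 1) * norm (w z))) \<in> borel_measurable lebesgue"
    by measurable
  moreover have "indicator {0<..} (fst z) * norm (nonlin \<gamma> \<alpha> (u (fst z)) (snd z)) =
      norm (snd z) powr \<gamma> * norm (w z) powr (\<alpha> - 1) * norm (w z)" for z
    by (cases "0 < fst z") (simp_all add: w_def nonlin_def)
  ultimately show ?thesis by (simp only:)
qed

text \<open>
  A Borel version \<open>h\<close> of the size \<open>\<bar>y\<bar>\<^sup>\<gamma> \<bar>u\<bar>\<^sup>\<alpha>\<close> of the nonlinearity, extended by zero to negative times. Tonelli's
  theorem needs measurability for product measures, while solutions are only Lebesgue measurable.
\<close>

definition source_density ::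
  "real \<Rightarrow> real \<Rightarrow> (real \<Rightarrow> 'a::euclidean_space \<Rightarrow> 'b::euclidean_space) \<Rightarrow> (real \<times> 'a \<Rightarrow> ennreal) \<Rightarrow> bool" where
  "source_density \<gamma> \<alpha> u h \<longleftrightarrow> h \<in> borel_measurable borel \<and>
     (AE z in lebesgue. h z = ennreal (indicator {0<..} (fst z) * norm (nonlin \<gamma> \<alpha> (u (fst z)) (snd z))))"

lemma source_density_exists:
  fixes u :: "real \<Rightarrow> 'a::euclidean_space \<Rightarrow> 'b::euclidean_space"
  assumes "(\<lambda>(t, x). u t x) \<in> borel_measurable (lebesgue_on ({0<..} \<times> UNIV))"
  obtains h where "source_density \<gamma> \<alpha> u h"
proof -
  from completion_ex_borel_measurable[OF nonlin_spacetime_measurable[OF assms, of \<gamma> \<alpha>]]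
  obtain h where "h \<in> borel_measurable lborel"
    "AE z in lborel. ennreal (indicator {0<..} (fst z) * norm (nonlin \<gamma> \<alpha> (u (fst z)) (snd z))) = h z"
    by blast
  then show thesis
    by (intro that[of h]) (auto simp: source_density_def AE_completion_iff elim: eventually_mono)
qed

lemma source_density_sections:
  assumes "source_density \<gamma> \<alpha> u h"
  shows "AE \<tau> in lebesgue. \<tau> > 0 \<longrightarrow> (AE y in lebesgue. h (\<tau>, y) = ennreal (norm (nonlin \<gamma> \<alpha> (u \<tau>) y)))"
proof -
  have "AE z in lebesgue. h z = ennreal (indicator {0<..} (fst z) * norm (nonlin \<gamma> \<alpha> (u (fst z)) (snd z)))"
    using assms by (simp add: source_density_def)
  from AE_lebesgue_pairD[OF this] show ?thesis
    by (rule eventually_mono) auto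
qed

text \<open>
  The two statements about almost every \<open>x\<close> are used separately: absolute convergence gives integrability of the
  source, the identity describes the Duhamel term.
\<close>

lemma solutionE:
  assumes "solution \<gamma> \<alpha> u0 u" "t > 0"
  obtains v where "represents v (heat_dist t u0)"
    and "AE x in lebesgue. set_integrable lebesgue ({0<..<t} \<times> UNIV)
      (\<lambda>(\<tau>, y). heat_kernel (t - \<tau>) (x - y) *\<^sub>R nonlin \<gamma> \<alpha> (u \<tau>) y)"
    and "AE x in lebesgue. u t x = v x +
      set_lebesgue_integral lebesgue {0<..<t} (\<lambda>\<tau>. heat (t - \<tau>) (nonlin \<gamma> \<alpha> (u \<tau>)) x)"
  using assms unfolding solution_def AE_conj_iff by blast

lemma heat_kernel_lower_bound:
  fixes w :: "'a::euclidean_space"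
  assumes s: "T \<le> s" "s \<le> 2 * T" and T: "T > 0" and w: "norm w \<le> r"
  shows "(8 * pi * T) powr (- real DIM('a) / 2) * exp (- r\<^sup>2 / (4 * T)) \<le> heat_kernel s w"
  unfolding heat_kernel_def
proof (intro mult_mono)
  show "(8 * pi * T) powr (- real DIM('a) / 2) \<le> (4 * pi * s) powr (- real DIM('a) / 2)"
    using s T by (intro powr_mono2') auto
  have "(norm w)\<^sup>2 / (4 * s) \<le> r\<^sup>2 / (4 * T)"
    using s T w by (intro frac_le power_mono) auto
  then show "exp (- r\<^sup>2 / (4 * T)) \<le> exp (- (norm w)\<^sup>2 / (4 * s))" by simp
qed auto

text \<open>
  Absolute convergence of the Duhamel integral at a single point \<open>x\<close> and the single time \<open>2 T\<close> suffices: up to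
  time \<open>T\<close> and on a bounded set, the kernel seen from there is bounded below by a positive constant.
\<close>

lemma source_locally_integrable:
  fixes u :: "real \<Rightarrow> 'a::euclidean_space \<Rightarrow> 'b::{real_normed_field,euclidean_space}"
  assumes sol: "solution \<gamma> \<alpha> u0 u" and h: "source_density \<gamma> \<alpha> u h" and T: "T > 0"
  shows "(\<integral>\<^sup>+z\<in>{0<..<T} \<times> cball 0 R. h z \<partial>lborel) < \<infinity>"
proof -
  have [measurable]: "h \<in> borel_measurable borel" using h by (simp add: source_density_def)
  let ?n = "\<lambda>z. nonlin \<gamma> \<alpha> (u (fst z)) (snd z)"
  \<comment> \<open>the time horizon is doubled to keep the kernel away from its singularity on \<open>(0, T)\<close>\<close>
  have "2 * T > 0" using T by simp
  with sol have "AE x in lebesgue. set_integrable lebesgue ({0<..<2 * T} \<times> UNIV)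
      (\<lambda>(\<tau>, y). heat_kernel (2 * T - \<tau>) (x - y) *\<^sub>R nonlin \<gamma> \<alpha> (u \<tau>) y)"
    by (rule solutionE)
  then obtain x where "set_integrable lebesgue ({0<..<2 * T} \<times> UNIV)
      (\<lambda>(\<tau>, y). heat_kernel (2 * T - \<tau>) (x - y) *\<^sub>R nonlin \<gamma> \<alpha> (u \<tau>) y)"
    by (rule AE_lebesgue_ex)
  then have fin: "(\<integral>\<^sup>+z. ennreal (norm (indicator ({0<..<2 * T} \<times> UNIV) z *\<^sub>R
      (heat_kernel (2 * T - fst z) (x - snd z) *\<^sub>R ?n z))) \<partial>lebesgue) < \<infinity>"
    by (simp add: set_integrable_def integrable_iff_bounded case_prod_unfold)
  let ?r = "norm x + R"
  define c where "c = (8 * pi * T) powr (- real DIM('a) / 2) * exp (- ?r\<^sup>2 / (4 * T))"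
  have c: "c > 0" using T by (simp add: c_def)
  have "ennreal c * (\<integral>\<^sup>+z\<in>{0<..<T} \<times> cball 0 R. h z \<partial>lborel)
      = (\<integral>\<^sup>+z. ennreal c * (h z * indicator ({0<..<T} \<times> cball 0 R) z) \<partial>lborel)"
    by (rule nn_integral_cmult[symmetric]) measurable
  also have "\<dots> = (\<integral>\<^sup>+z. ennreal c * (h z * indicator ({0<..<T} \<times> cball 0 R) z) \<partial>lebesgue)"
    by (rule nn_integral_completion[symmetric])
  also have "\<dots> \<le> (\<integral>\<^sup>+z. ennreal (norm (indicator ({0<..<2 * T} \<times> UNIV) z *\<^sub>R
      (heat_kernel (2 * T - fst z) (x - snd z) *\<^sub>R ?n z))) \<partial>lebesgue)"
  proof (rule nn_integral_mono_AE)
    have "AE z in lebesgue. h z = ennreal (indicator {0<..} (fst z) * norm (?n z))"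
      using h by (simp add: source_density_def)
    then show "AE z in lebesgue. ennreal c * (h z * indicator ({0<..<T} \<times> cball 0 R) z) \<le>
        ennreal (norm (indicator ({0<..<2 * T} \<times> UNIV) z *\<^sub>R (heat_kernel (2 * T - fst z) (x - snd z) *\<^sub>R ?n z)))"
    proof (rule eventually_mono)
      fix z :: "real \<times> 'a"
      assume hz: "h z = ennreal (indicator {0<..} (fst z) * norm (?n z))"
      show "ennreal c * (h z * indicator ({0<..<T} \<times> cball 0 R) z) \<le>
        ennreal (norm (indicator ({0<..<2 * T} \<times> UNIV) z *\<^sub>R (heat_kernel (2 * T - fst z) (x - snd z) *\<^sub>R ?n z)))"
      proof (cases "z \<in> {0<..<T} \<times> cball 0 R")
        case True
        obtain \<tau> y where z: "z = (\<tau>, y)" by (cases z)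
        have "norm (x - y) \<le> ?r"
          using True norm_triangle_ineq4[of x y] by (simp add: z)
        then have "c \<le> heat_kernel (2 * T - \<tau>) (x - y)"
          unfolding c_def using True T by (intro heat_kernel_lower_bound) (auto simp: z)
        then have "c * norm (?n z) \<le> heat_kernel (2 * T - \<tau>) (x - y) * norm (?n z)"
          by (rule mult_right_mono) simp
        then show ?thesis
          using True c by (simp add: z hz[unfolded z] ennreal_mult'[symmetric] heat_kernel_nonneg ennreal_leI)
      qed simp
    qed
  qed
  finally have "ennreal c * (\<integral>\<^sup>+z\<in>{0<..<T} \<times> cball 0 R. h z \<partial>lborel) < \<infinity>"
    using fin by (rule le_less_trans)
  then show ?thesis using c by (auto simp: ennreal_mult_less_top)
qed

text \<open>
  For each fixed positive time the identity holds for almost every \<open>y\<close>. It becomes an identity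
  almost everywhere in space-time since its two sides are Borel functions.
\<close>

lemma source_self_similar:
  fixes u :: "real \<Rightarrow> 'a::euclidean_space \<Rightarrow> 'b::{real_normed_field,euclidean_space}"
  assumes h: "source_density \<gamma> \<alpha> u h" and ss: "self_similar \<gamma> \<alpha> u"
    and \<beta>: "\<beta> = (2 + \<gamma>) / (\<alpha> - 1)" and \<alpha>: "\<alpha> \<noteq> 1" and k: "k > 0"
  shows "AE z in lborel. fst z > 0 \<longrightarrow> h z = ennreal (k powr (\<beta> + 2)) * h (k\<^sup>2 * fst z, k *\<^sub>R snd z)"
proof -
  have [measurable]: "h \<in> borel_measurable borel" using h by (simp add: source_density_def)
  let ?P = "\<lambda>z::real \<times> 'a. fst z > 0 \<longrightarrow> h z = ennreal (k powr (\<beta> + 2)) * h (k\<^sup>2 * fst z, k *\<^sub>R snd z)"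
  have b: "\<beta> * (\<alpha> - 1) = 2 + \<gamma>" using \<beta> \<alpha> by simp
  have k2: "k\<^sup>2 > 0" using k by simp
  have "AE \<tau> in lebesgue. AE y in lebesgue. ?P (\<tau>, y)"
    using source_density_sections[OF h] AE_scaleR[OF k2 source_density_sections[OF h]]
  proof eventually_elim
    case (elim \<tau>)
    show ?case
    proof (cases "\<tau> > 0")
      case True
      then have k2t: "k\<^sup>2 * \<tau> > 0" using k by simp
      have "AE y in lebesgue. h (\<tau>, y) = ennreal (norm (nonlin \<gamma> \<alpha> (u \<tau>) y))" using elim True by simp
      moreover
      have "AE y in lebesgue. h (k\<^sup>2 * \<tau>, y) = ennreal (norm (nonlin \<gamma> \<alpha> (u (k\<^sup>2 * \<tau>)) y))"
        using elim(2) k2t by simp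
      from AE_scaleR[OF k this]
      have "AE y in lebesgue. h (k\<^sup>2 * \<tau>, k *\<^sub>R y) = ennreal (norm (nonlin \<gamma> \<alpha> (u (k\<^sup>2 * \<tau>)) (k *\<^sub>R y)))" .
      moreover have "AE y in lebesgue. rescale \<beta> k u \<tau> y = u \<tau> y"
        using ss k True by (simp add: self_similar_def rescale_def \<beta>)
      ultimately show ?thesis
      proof eventually_elim
        case (elim y)
        have "nonlin \<gamma> \<alpha> (u \<tau>) y = nonlin \<gamma> \<alpha> (rescale \<beta> k u \<tau>) y"
          by (simp add: nonlin_def elim(3))
        also have "\<dots> = k powr (\<beta> + 2) *\<^sub>R nonlin \<gamma> \<alpha> (u (k\<^sup>2 * \<tau>)) (k *\<^sub>R y)"
          by (rule nonlin_rescale[OF k b])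
        finally show ?case by (simp add: elim(1,2) ennreal_mult')
      qed
    qed simp
  qed
  then have "AE \<tau> in lborel. AE y in lborel. ?P (\<tau>, y)" by (simp add: AE_completion_iff)
  moreover have "{z \<in> space (lborel \<Otimes>\<^sub>M lborel). ?P z} \<in> sets (lborel \<Otimes>\<^sub>M lborel)"
  proof -
    have "continuous_on UNIV (\<lambda>z::real \<times> 'a. (k\<^sup>2 * fst z, k *\<^sub>R snd z))"
      by (intro continuous_intros)
    then have "(\<lambda>z::real \<times> 'a. (k\<^sup>2 * fst z, k *\<^sub>R snd z)) \<in> borel_measurable borel"
      by (rule borel_measurable_continuous_onI)
    then have [measurable]: "(\<lambda>z. h (k\<^sup>2 * fst z, k *\<^sub>R snd z)) \<in> borel_measurable borel"
      by (rule measurable_compose) (rule \<open>h \<in> borel_measurable borel\<close>)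
    let ?A = "{z::real \<times> 'a. fst z > 0}"
    let ?B = "{z \<in> space borel. h z = ennreal (k powr (\<beta> + 2)) * h (k\<^sup>2 * fst z, k *\<^sub>R snd z)}"
    have "open ?A" by (intro open_Collect_less continuous_intros)
    then have "?A \<in> sets borel" by (rule borel_open)
    moreover have "?B \<in> sets borel" by (rule borel_measurable_eq) measurable
    ultimately have "- ?A \<union> ?B \<in> sets borel" by (intro sets.Un borel_comp)
    moreover have "{z. ?P z} = - ?A \<union> ?B" by auto
    ultimately have "{z. ?P z} \<in> sets borel" by (simp only:)
    then show ?thesis unfolding lborel_prod by (simp only: sets_lborel space_lborel space_borel UNIV_I simp_thms)
  qed
  ultimately have "AE z in lborel \<Otimes>\<^sub>M lborel. ?P z"
    by (intro lborel_pair.AE_pair_measure)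
  then show ?thesis unfolding lborel_prod .
qed

lemma parabolic_jacobian:
  assumes "k > 0"
  shows "(\<Prod>j\<in>Basis. \<bar>parabolic_weight k (j :: real \<times> 'a::euclidean_space)\<bar>) = k ^ (DIM('a) + 2)"
  unfolding Basis_prod_def parabolic_weight_def using assms
  by (subst prod.union_disjoint)
     (auto simp: prod.reindex inj_on_def nonzero_Basis power_add power2_eq_square cong: prod.cong)

text \<open>
  The mass of the source on \<open>(0, k\<^sup>2 T) \<times> B(k)\<close> is \<open>k\<close> to the power \<open>d - \<beta>\<close> times its mass on \<open>(0, T) \<times> B(1)\<close>: the
  Jacobian has exponent \<open>d + 2\<close>, and the source itself is homogeneous of degree \<open>-(\<beta> + 2)\<close>. Thus self-similarity turns
  local integrability into polynomial growth at infinity.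
\<close>

lemma source_growth:
  fixes u :: "real \<Rightarrow> 'a::euclidean_space \<Rightarrow> 'b::{real_normed_field,euclidean_space}"
  assumes h: "source_density \<gamma> \<alpha> u h" and ss: "self_similar \<gamma> \<alpha> u"
    and \<beta>: "(2 + \<gamma>) / (\<alpha> - 1) \<ge> 0" and \<alpha>: "\<alpha> \<noteq> 1" and k: "k \<ge> 1" and T: "T > 0"
  shows "(\<integral>\<^sup>+z\<in>{0<..<T} \<times> cball 0 k. h z \<partial>lborel)
    \<le> ennreal (k ^ DIM('a)) * (\<integral>\<^sup>+z\<in>{0<..<T} \<times> cball 0 1. h z \<partial>lborel)"
proof -
  have [measurable]: "h \<in> borel_measurable borel" using h by (simp add: source_density_def)
  define b where "b = (2 + \<gamma>) / (\<alpha> - 1)"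
  have b0: "b \<ge> 0" using \<beta> by (simp add: b_def)
  have k0: "k > 0" using k by simp
  have k2: "k\<^sup>2 \<ge> 1" using k by (rule one_le_power)
  define F where "F z = h z * indicator ({0<..<k\<^sup>2 * T} \<times> cball 0 k) z" for z
  have [measurable]: "F \<in> borel_measurable lebesgue"
    unfolding F_def[abs_def] by (rule measurable_completion) measurable
  have "a < k\<^sup>2 * T" if "a < T" for a
    using less_le_trans[OF that, of "k\<^sup>2 * T"] mult_right_mono[OF k2, of T] T by simp
  then have sub: "{0<..<T} \<times> cball (0::'a) k \<subseteq> {0<..<k\<^sup>2 * T} \<times> cball 0 k"
    by auto
  have ind: "(indicator ({0<..<k\<^sup>2 * T} \<times> cball 0 k) (k\<^sup>2 * fst z, k *\<^sub>R snd z) :: ennreal) =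
      indicator ({0<..<T} \<times> cball 0 1) z" for z :: "real \<times> 'a"
    using k0 by (cases z) (simp add: indicator_def zero_less_mult_iff)
  \<comment> \<open>lengthening the time interval makes the domain the image of \<open>(0, T) \<times> B(1)\<close> under the dilation\<close>
  have "(\<integral>\<^sup>+z\<in>{0<..<T} \<times> cball 0 k. h z \<partial>lborel) \<le> (\<integral>\<^sup>+z. F z \<partial>lborel)"
    unfolding F_def using sub by (intro nn_integral_mono) (auto split: split_indicator)
  also have "\<dots> = (\<integral>\<^sup>+z. F z \<partial>lebesgue)" by (rule nn_integral_completion[symmetric])
  also have "\<dots> = ennreal (k ^ (DIM('a) + 2)) * (\<integral>\<^sup>+z. F (k\<^sup>2 * fst z, k *\<^sub>R snd z) \<partial>lebesgue)"
    using nn_integral_dilation[of "parabolic_weight k" F, OF parabolic_weight_nonzero[OF k0]]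
    unfolding parabolic_jacobian[OF k0] dilation_parabolic'[OF k0] by simp
  also have "(\<integral>\<^sup>+z. F (k\<^sup>2 * fst z, k *\<^sub>R snd z) \<partial>lebesgue) =
      (\<integral>\<^sup>+z. F (k\<^sup>2 * fst z, k *\<^sub>R snd z) \<partial>lborel)" by (rule nn_integral_completion)
  also have "\<dots> = (\<integral>\<^sup>+z. ennreal (k powr (- (b + 2))) * (h z * indicator ({0<..<T} \<times> cball 0 1) z) \<partial>lborel)"
    using source_self_similar[OF h ss b_def \<alpha> k0]
  proof (intro nn_integral_cong_AE, eventually_elim)
    case (elim z)
    show ?case
    proof (cases "fst z > 0")
      case True
      have "ennreal (k powr (- (b + 2))) * ennreal (k powr (b + 2)) = 1"
        using k0 by (simp add: ennreal_mult'[symmetric] powr_add[symmetric])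
      then have "ennreal (k powr (- (b + 2))) * h z = h (k\<^sup>2 * fst z, k *\<^sub>R snd z)"
        using elim True by (simp add: mult.assoc[symmetric])
      then show ?thesis unfolding F_def ind by (simp add: mult.assoc[symmetric])
    next
      case False
      then have "indicator ({0<..<T} \<times> cball 0 1) z = (0::ennreal)"
        by (cases z) simp
      then show ?thesis unfolding F_def ind by simp
    qed
  qed
  also have "\<dots> = ennreal (k powr (- (b + 2))) * (\<integral>\<^sup>+z\<in>{0<..<T} \<times> cball 0 1. h z \<partial>lborel)"
    by (rule nn_integral_cmult) measurable
  also have "ennreal (k ^ (DIM('a) + 2)) * \<dots> =
      ennreal (k ^ (DIM('a) + 2) * k powr (- (b + 2))) * (\<integral>\<^sup>+z\<in>{0<..<T} \<times> cball 0 1. h z \<partial>lborel)"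
    using k0 by (simp add: ennreal_mult' mult.assoc)
  also have "\<dots> \<le> ennreal (k ^ DIM('a)) * (\<integral>\<^sup>+z\<in>{0<..<T} \<times> cball 0 1. h z \<partial>lborel)"
  proof (intro mult_right_mono ennreal_leI)
    have "k ^ (DIM('a) + 2) * k powr (- (b + 2)) = k powr (real DIM('a) - b)"
      using k0 by (subst powr_realpow[symmetric]) (auto simp: powr_add[symmetric])
    also have "\<dots> \<le> k powr real DIM('a)" using k b0 by (intro powr_mono) auto
    also have "\<dots> = k ^ DIM('a)" using k0 by (simp add: powr_realpow)
    finally show "k ^ (DIM('a) + 2) * k powr (- (b + 2)) \<le> k ^ DIM('a)" .
  qed auto
  finally show ?thesis .
qed

definition weighted_source :: "(real \<times> 'a::euclidean_space \<Rightarrow> ennreal) \<Rightarrow> real \<Rightarrow> ennreal" where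
  "weighted_source h T = (\<integral>\<^sup>+z. h z * ennreal (decay (snd z)) * indicator {0<..<T} (fst z) \<partial>lborel)"

lemma weighted_source_finite:
  fixes u :: "real \<Rightarrow> 'a::euclidean_space \<Rightarrow> 'b::{real_normed_field,euclidean_space}"
  assumes sol: "solution \<gamma> \<alpha> u0 u" and h: "source_density \<gamma> \<alpha> u h" and ss: "self_similar \<gamma> \<alpha> u"
    and \<beta>: "(2 + \<gamma>) / (\<alpha> - 1) \<ge> 0" and \<alpha>: "\<alpha> \<noteq> 1" and T: "T > 0"
  shows "weighted_source h T < \<infinity>"
proof -
  have [measurable]: "h \<in> borel_measurable borel" using h by (simp add: source_density_def)
  define C where "C = (\<integral>\<^sup>+z\<in>{0<..<T} \<times> cball 0 1. h z \<partial>lborel)"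
  let ?M = "density lborel (\<lambda>z. h z * indicator {0<..<T} (fst z))"
  have "(\<integral>\<^sup>+z. ennreal (1 / (1 + norm (snd z)) ^ (DIM('a) + 2)) \<partial>?M) \<le> ennreal (\<Sum>n. 1 / (real n + 1)\<^sup>2) * C"
  proof (rule nn_integral_decay_le)
    fix n :: nat
    have "emeasure ?M {z \<in> space ?M. norm (snd z) \<le> real n + 1} =
        (\<integral>\<^sup>+z\<in>{0<..<T} \<times> cball 0 (real n + 1). h z \<partial>lborel)"
      by (subst emeasure_density) (auto intro!: nn_integral_cong split: split_indicator)
    also have "\<dots> \<le> ennreal ((real n + 1) ^ DIM('a)) * C"
      unfolding C_def by (rule source_growth[OF h ss \<beta> \<alpha> _ T]) simp
    finally show "emeasure ?M {z \<in> space ?M. norm (snd z) \<le> real n + 1} \<le> ennreal ((real n + 1) ^ DIM('a)) * C" .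
  qed auto
  also have "\<dots> < \<infinity>"
    using source_locally_integrable[OF sol h T, of 1] by (simp add: C_def ennreal_mult_less_top)
  finally show ?thesis
    unfolding weighted_source_def decay_def
    by (subst (asm) nn_integral_density) (auto simp: mult_ac)
qed

text \<open>
  Dominated convergence: each point leaves the shrinking time slabs.
\<close>

lemma weighted_source_tendsto_0:
  assumes [measurable]: "h \<in> borel_measurable borel" and fin: "\<And>T. T > 0 \<Longrightarrow> weighted_source h T < \<infinity>"
    and X: "X \<longlonglongrightarrow> 0" "\<And>n::nat. X n > 0"
  shows "(\<lambda>n. weighted_source h (X n)) \<longlonglongrightarrow> 0"
proof -
  obtain B where B: "\<And>n. X n \<le> B"
    using convergent_imp_Bseq[OF convergentI[OF X(1)]] by (auto simp: Bseq_def abs_le_iff)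
  have "B > 0" using X(2)[of 0] B[of 0] by simp
  have "(\<lambda>n. \<integral>\<^sup>+z. h z * ennreal (decay (snd z)) * indicator {0<..<X n} (fst z) \<partial>lborel)
      \<longlonglongrightarrow> (\<integral>\<^sup>+z. 0 \<partial>(lborel :: (real \<times> 'a) measure))"
  proof (rule nn_integral_dominated_convergence[where w="\<lambda>z. h z * ennreal (decay (snd z)) * indicator {0<..<B} (fst z)"])
    show "(\<integral>\<^sup>+z. h z * ennreal (decay (snd z)) * indicator {0<..<B} (fst z) \<partial>lborel) < \<infinity>"
      using fin[OF \<open>B > 0\<close>] by (simp add: weighted_source_def)
    show "AE z in lborel. h z * ennreal (decay (snd z)) * indicator {0<..<X n} (fst z)
        \<le> h z * ennreal (decay (snd z)) * indicator {0<..<B} (fst z)" for n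
      using B[of n] by (auto intro!: always_eventually mult_left_mono split: split_indicator)
    show "AE z in lborel. (\<lambda>n. h z * ennreal (decay (snd z)) * indicator {0<..<X n} (fst z)) \<longlonglongrightarrow> 0"
    proof (intro always_eventually allI)
      fix z :: "real \<times> 'a"
      show "(\<lambda>n. h z * ennreal (decay (snd z)) * indicator {0<..<X n} (fst z)) \<longlonglongrightarrow> 0"
      proof (cases "fst z > 0")
        case True
        with X(1) have "\<forall>\<^sub>F n in sequentially. X n < fst z" by (rule order_tendstoD)
        then have "\<forall>\<^sub>F n in sequentially. h z * ennreal (decay (snd z)) * indicator {0<..<X n} (fst z) = 0"
          by eventually_elim simp
        then show ?thesis by (rule tendsto_eventually)
      qed simp
    qed
  qed measurable
  then show ?thesis by (simp add: weighted_source_def)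
qed

section \<open>The Duhamel term and the initial trace\<close>

text \<open>
  By Tonelli's theorem the heat kernel acts on the weight instead of on the source, and the heat flow
  preserves the weight.
\<close>

lemma duhamel_decay_le:
  fixes h :: "real \<times> 'a::euclidean_space \<Rightarrow> ennreal"
  assumes [measurable]: "h \<in> borel_measurable borel" and t: "t > 0"
  shows "(\<integral>\<^sup>+x. (\<integral>\<^sup>+z. ennreal (heat_kernel (t - fst z) (x - snd z)) * h z * indicator {0<..<t} (fst z) \<partial>lborel) * ennreal (decay x) \<partial>lborel)
    \<le> ennreal (heat_decay_const TYPE('a) t) * weighted_source h t"
proof -
  let ?k = "\<lambda>x z. ennreal (heat_kernel (t - fst z) (x - snd z)) * h z * indicator {0<..<t} (fst z)"
  let ?C = "ennreal (heat_decay_const TYPE('a) t)"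
  have "(\<integral>\<^sup>+x. (\<integral>\<^sup>+z. ?k x z \<partial>lborel) * ennreal (decay x) \<partial>lborel)
      = (\<integral>\<^sup>+x. (\<integral>\<^sup>+z. ?k x z * ennreal (decay x) \<partial>lborel) \<partial>lborel)"
    by (intro nn_integral_cong nn_integral_multc[symmetric]) measurable
  also have "\<dots> = (\<integral>\<^sup>+z. (\<integral>\<^sup>+x. ?k x z * ennreal (decay x) \<partial>lborel) \<partial>lborel)"
    by (rule lborel_pair.Fubini'[symmetric]) measurable
  also have "\<dots> \<le> (\<integral>\<^sup>+z. ?C * (h z * ennreal (decay (snd z)) * indicator {0<..<t} (fst z)) \<partial>lborel)"
  proof (intro nn_integral_mono)
    fix z :: "real \<times> 'a"
    show "(\<integral>\<^sup>+x. ?k x z * ennreal (decay x) \<partial>lborel) \<le> ?C * (h z * ennreal (decay (snd z)) * indicator {0<..<t} (fst z))"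
    proof (cases "fst z \<in> {0<..<t}")
      case True
      let ?s = "t - fst z"
      have "(\<integral>\<^sup>+x. ?k x z * ennreal (decay x) \<partial>lborel) =
          (\<integral>\<^sup>+x. h z * (ennreal (heat_kernel ?s (snd z - x)) * ennreal (decay x)) \<partial>lborel)"
        using True by (intro nn_integral_cong) (simp add: heat_kernel_minus[of _ "snd z"] mult_ac)
      also have "\<dots> = h z * (\<integral>\<^sup>+x. ennreal (heat_kernel ?s (snd z - x)) * ennreal (decay x) \<partial>lborel)"
        by (rule nn_integral_cmult) measurable
      also have "\<dots> \<le> h z * ennreal (heat_decay_const TYPE('a) ?s * decay (snd z))"
        using True by (intro mult_left_mono heat_decay_le) auto
      also have "\<dots> \<le> h z * ennreal (heat_decay_const TYPE('a) t * decay (snd z))"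
        using True decay_pos[of "snd z"]
        by (intro mult_left_mono ennreal_leI mult_right_mono heat_decay_const_mono) auto
      also have "\<dots> = ?C * (h z * ennreal (decay (snd z)) * indicator {0<..<t} (fst z))"
        using True decay_pos[of "snd z"]
        by (simp add: ennreal_mult' heat_decay_const_nonneg less_imp_le mult_ac)
      finally show ?thesis .
    qed simp
  qed
  also have "\<dots> = ?C * weighted_source h t"
    unfolding weighted_source_def by (rule nn_integral_cmult) measurable
  finally show ?thesis .
qed

text \<open>
  The Duhamel term is an iterated integral; its modulus is at most the double integral of the moduli,
  in which the nonlinearity may be replaced by its Borel version.
\<close>

lemma duhamel_pointwise_le:
  fixes u :: "real \<Rightarrow> 'a::euclidean_space \<Rightarrow> 'b::{real_normed_field,euclidean_space}"
  assumes h: "source_density \<gamma> \<alpha> u h"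
  shows "ennreal (norm (set_lebesgue_integral lebesgue {0<..<t} (\<lambda>\<tau>. heat (t - \<tau>) (nonlin \<gamma> \<alpha> (u \<tau>)) x)))
    \<le> (\<integral>\<^sup>+z. ennreal (heat_kernel (t - fst z) (x - snd z)) * h z * indicator {0<..<t} (fst z) \<partial>lborel)"
proof -
  have [measurable]: "h \<in> borel_measurable borel" using h by (simp add: source_density_def)
  let ?k = "\<lambda>\<tau> y. ennreal (heat_kernel (t - \<tau>) (x - y)) * h (\<tau>, y) * indicator {0<..<t} \<tau>"
  have "ennreal (norm (set_lebesgue_integral lebesgue {0<..<t} (\<lambda>\<tau>. heat (t - \<tau>) (nonlin \<gamma> \<alpha> (u \<tau>)) x)))
      \<le> (\<integral>\<^sup>+\<tau>. ennreal (norm (indicator {0<..<t} \<tau> *\<^sub>R heat (t - \<tau>) (nonlin \<gamma> \<alpha> (u \<tau>)) x)) \<partial>lebesgue)"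
    unfolding set_lebesgue_integral_def by (rule norm_integral_le_nn_integral)
  also have "\<dots> \<le> (\<integral>\<^sup>+\<tau>. (\<integral>\<^sup>+y. ?k \<tau> y \<partial>lborel) \<partial>lebesgue)"
  proof (rule nn_integral_mono_AE, use source_density_sections[OF h] in eventually_elim)
    case (elim \<tau>)
    show ?case
    proof (cases "\<tau> \<in> {0<..<t}")
      case True
      have "ennreal (norm (heat (t - \<tau>) (nonlin \<gamma> \<alpha> (u \<tau>)) x))
          \<le> (\<integral>\<^sup>+y. ennreal (norm (heat_kernel (t - \<tau>) (x - y) *\<^sub>R nonlin \<gamma> \<alpha> (u \<tau>) y)) \<partial>lebesgue)"
        unfolding heat_def by (rule norm_integral_le_nn_integral)
      also have "\<dots> = (\<integral>\<^sup>+y. ?k \<tau> y \<partial>lebesgue)"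
      proof (rule nn_integral_cong_AE)
        have "AE y in lebesgue. h (\<tau>, y) = ennreal (norm (nonlin \<gamma> \<alpha> (u \<tau>) y))"
          using elim True by simp
        then show "AE y in lebesgue. ennreal (norm (heat_kernel (t - \<tau>) (x - y) *\<^sub>R nonlin \<gamma> \<alpha> (u \<tau>) y)) = ?k \<tau> y"
          by eventually_elim (use True in \<open>simp add: heat_kernel_nonneg ennreal_mult'\<close>)
      qed
      also have "\<dots> = (\<integral>\<^sup>+y. ?k \<tau> y \<partial>lborel)" by (rule nn_integral_completion)
      finally show ?thesis using True by simp
    qed simp
  qed
  also have "\<dots> = (\<integral>\<^sup>+\<tau>. (\<integral>\<^sup>+y. ?k \<tau> y \<partial>lborel) \<partial>lborel)" by (rule nn_integral_completion)
  also have "\<dots> = (\<integral>\<^sup>+z. ?k (fst z) (snd z) \<partial>(lborel \<Otimes>\<^sub>M lborel))"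
    by (subst lborel.nn_integral_fst[symmetric]) (simp_all add: lborel_prod)
  finally show ?thesis unfolding lborel_prod by simp
qed

lemma duhamel_weighted:
  fixes u :: "real \<Rightarrow> 'a::euclidean_space \<Rightarrow> 'b::{real_normed_field,euclidean_space}"
  assumes h: "source_density \<gamma> \<alpha> u h" and t: "t > 0"
    and N: "AE x in lebesgue. N x =
      set_lebesgue_integral lebesgue {0<..<t} (\<lambda>\<tau>. heat (t - \<tau>) (nonlin \<gamma> \<alpha> (u \<tau>)) x)"
  shows "(\<integral>\<^sup>+x. ennreal (norm (N x) * decay x) \<partial>lebesgue)
    \<le> ennreal (heat_decay_const TYPE('a) t) * weighted_source h t"
proof -
  have hb: "h \<in> borel_measurable borel" using h by (simp add: source_density_def)
  let ?D = "\<lambda>x. \<integral>\<^sup>+z. ennreal (heat_kernel (t - fst z) (x - snd z)) * h z * indicator {0<..<t} (fst z) \<partial>lborel"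
  have "(\<integral>\<^sup>+x. ennreal (norm (N x) * decay x) \<partial>lebesgue) \<le> (\<integral>\<^sup>+x. ?D x * ennreal (decay x) \<partial>lebesgue)"
  proof (rule nn_integral_mono_AE, use N in eventually_elim)
    case (elim x)
    have "ennreal (norm (N x)) * ennreal (decay x) \<le> ?D x * ennreal (decay x)"
      unfolding elim by (intro mult_right_mono duhamel_pointwise_le h) simp
    then show ?case by (simp add: ennreal_mult')
  qed
  also have "\<dots> = (\<integral>\<^sup>+x. ?D x * ennreal (decay x) \<partial>lborel)" by (rule nn_integral_completion)
  also have "\<dots> \<le> ennreal (heat_decay_const TYPE('a) t) * weighted_source h t"
    by (rule duhamel_decay_le[OF hb t])
  finally show ?thesis .
qed


text \<open>
  Paired with \<open>\<psi>\<close>, the free part is \<open>\<integral> \<phi> e\<^sup>t\<^sup>\<Delta> \<psi>\<close>, which tends to \<open>\<integral> \<phi> \<psi>\<close>. The Duhamel part is bounded by a constant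
  times the weighted mass of the source up to time \<open>t\<close>, which tends to \<open>0\<close>.
\<close>

lemma self_similar_tends_to_initial:
  fixes u :: "real \<Rightarrow> 'a::euclidean_space \<Rightarrow> 'b::{real_normed_field,euclidean_space}"
  assumes \<phi>: "\<phi> \<in> borel_measurable lebesgue"
    and \<phi>_fin: "(\<integral>\<^sup>+x. ennreal (norm (\<phi> x) * decay x) \<partial>lebesgue) < \<infinity>"
    and sol: "solution \<gamma> \<alpha> (regular_dist \<phi>) u" and ss: "self_similar \<gamma> \<alpha> u"
    and meas: "\<And>t. t > 0 \<Longrightarrow> u t \<in> borel_measurable lebesgue"
    and \<beta>: "(2 + \<gamma>) / (\<alpha> - 1) \<ge> 0" and \<alpha>: "\<alpha> \<noteq> 1"
  shows "tends_to_initial u (regular_dist \<phi>)"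
proof -
  have "(\<lambda>(t, x). u t x) \<in> borel_measurable (lebesgue_on ({0<..} \<times> UNIV))"
    using sol by (simp add: solution_def)
  then obtain h where h: "source_density \<gamma> \<alpha> u h" by (rule source_density_exists)
  then have hb: "h \<in> borel_measurable borel" by (simp add: source_density_def)
  define I where "I t = enn2real (weighted_source h t)" for t
  let ?C = "heat_decay_const TYPE('a)"
  have fin: "weighted_source h t < \<infinity>" if "t > 0" for t
    by (rule weighted_source_finite[OF sol h ss \<beta> \<alpha> that])
  have I: "weighted_source h t = ennreal (I t)" if "t > 0" for t
    using fin[OF that] by (simp add: I_def)
  have main: "tempered_function (u t) \<and> (\<forall>\<psi>\<in>schwartz.
      norm (regular_dist (u t) \<psi> - regular_dist \<phi> (heat t \<psi>))
        \<le> schwartz_seminorm (DIM('a) + 2) [] \<psi> * ?C t * I t)" if t: "t > 0" for t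
  proof -
    obtain v where v: "represents v (heat_dist t (regular_dist \<phi>))"
      and eq: "AE x in lebesgue. u t x = v x +
        set_lebesgue_integral lebesgue {0<..<t} (\<lambda>\<tau>. heat (t - \<tau>) (nonlin \<gamma> \<alpha> (u \<tau>)) x)"
      using sol t by (rule solutionE)
    \<comment> \<open>almost everywhere the Duhamel term, but measurable by definition\<close>
    define N where "N x = u t x - v x" for x
    have tv: "tempered_function v" using v by (simp add: represents_def)
    have N_meas: "N \<in> borel_measurable lebesgue"
      unfolding N_def[abs_def] by (intro borel_measurable_diff meas t tempered_functionD(1)[OF tv])
    have "AE x in lebesgue. N x =
        set_lebesgue_integral lebesgue {0<..<t} (\<lambda>\<tau>. heat (t - \<tau>) (nonlin \<gamma> \<alpha> (u \<tau>)) x)"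
      using eq by eventually_elim (simp add: N_def)
    from duhamel_weighted[OF h t this]
    have N_le: "(\<integral>\<^sup>+x. ennreal (norm (N x) * decay x) \<partial>lebesgue) \<le> ennreal (?C t * I t)"
      by (simp add: I[OF t] ennreal_mult' heat_decay_const_nonneg)
    then have N_fin: "(\<integral>\<^sup>+x. ennreal (norm (N x) * decay x) \<partial>lebesgue) < \<infinity>"
      by (rule le_less_trans) simp
    have tN: "tempered_function N" by (rule tempered_function_weighted[OF N_meas N_fin])
    have uvN: "u t = (\<lambda>x. v x + N x)" by (simp add: N_def)
    show ?thesis
    proof (intro conjI ballI)
      show "tempered_function (u t)" unfolding uvN by (rule tempered_function_add[OF tv tN])
      fix \<psi> :: "'a \<Rightarrow> 'b" assume \<psi>: "\<psi> \<in> schwartz"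
      let ?S = "schwartz_seminorm (DIM('a) + 2) [] \<psi>"
      have S: "0 \<le> ?S" by (rule schwartz_seminorm_nonneg[OF \<psi>]) simp
      have \<psi>_meas: "\<psi> \<in> borel_measurable lebesgue"
        using schwartz_regularity(2)[OF \<psi>] by (simp add: measurable_completion)
      have "regular_dist (u t) \<psi> = regular_dist v \<psi> + regular_dist N \<psi>"
        unfolding uvN by (rule regular_dist_add[OF tv tN \<psi>])
      also have "regular_dist v \<psi> = regular_dist \<phi> (heat t \<psi>)"
        using v \<psi> by (simp add: represents_def heat_dist_def)
      finally have diff: "regular_dist (u t) \<psi> - regular_dist \<phi> (heat t \<psi>) = regular_dist N \<psi>" by simp
      have "ennreal (norm (regular_dist N \<psi>)) \<le> ennreal ?S * (\<integral>\<^sup>+x. ennreal (norm (N x) * decay x) \<partial>lebesgue)"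
        by (rule regular_dist_weighted(2)[OF N_meas N_fin \<psi>_meas schwartz_decay[OF \<psi>]])
      also have "\<dots> \<le> ennreal ?S * ennreal (?C t * I t)" by (rule mult_left_mono[OF N_le]) simp
      also have "\<dots> = ennreal (?S * ?C t * I t)" using S by (simp add: ennreal_mult'[symmetric] mult.assoc)
      finally show "norm (regular_dist (u t) \<psi> - regular_dist \<phi> (heat t \<psi>)) \<le> ?S * ?C t * I t"
        unfolding diff using S by (simp add: I_def heat_decay_const_nonneg)
    qed
  qed
  show ?thesis
    unfolding tends_to_initial_def
  proof (intro conjI allI impI ballI)
    show "tempered_function (u t)" if "t > 0" for t using main[OF that] by blast
    fix \<psi> :: "'a \<Rightarrow> 'b" assume \<psi>: "\<psi> \<in> schwartz"
    let ?S = "schwartz_seminorm (DIM('a) + 2) [] \<psi>"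
    have S: "0 \<le> ?S" by (rule schwartz_seminorm_nonneg[OF \<psi>]) simp
    have "((\<lambda>t. regular_dist (u t) \<psi> - regular_dist \<phi> (heat t \<psi>)) \<longlongrightarrow> 0) (at_right 0)"
      unfolding tendsto_at_iff_sequentially
    proof (intro allI impI, unfold comp_def)
      fix X :: "nat \<Rightarrow> real" assume "\<forall>n. X n \<in> {0<..} - {0}" and lim: "X \<longlonglongrightarrow> 0"
      then have X: "\<And>n. X n > 0" by auto
      obtain B where B: "\<And>n. X n \<le> B"
        using convergent_imp_Bseq[OF convergentI[OF lim]] by (auto simp: Bseq_def abs_le_iff)
      have "(\<lambda>n. ennreal (I (X n))) \<longlonglongrightarrow> ennreal 0"
        using weighted_source_tendsto_0[OF hb fin lim X] by (simp add: I[OF X])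
      then have "(\<lambda>n. I (X n)) \<longlonglongrightarrow> 0"
        by (subst (asm) tendsto_ennreal_iff) (auto simp: I_def)
      then have "(\<lambda>n. ?S * ?C B * I (X n)) \<longlonglongrightarrow> 0" by (rule tendsto_mult_right_zero)
      then show "(\<lambda>n. regular_dist (u (X n)) \<psi> - regular_dist \<phi> (heat (X n) \<psi>)) \<longlonglongrightarrow> 0"
      proof (rule Lim_null_comparison[rotated], intro always_eventually allI)
        fix n
        have "norm (regular_dist (u (X n)) \<psi> - regular_dist \<phi> (heat (X n) \<psi>)) \<le> ?S * ?C (X n) * I (X n)"
          using main[OF X[of n]] \<psi> by blast
        also have "\<dots> \<le> ?S * ?C B * I (X n)"
          using S by (intro mult_right_mono mult_left_mono heat_decay_const_mono B) (simp_all add: I_def)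
        finally show "norm (regular_dist (u (X n)) \<psi> - regular_dist \<phi> (heat (X n) \<psi>)) \<le> ?S * ?C B * I (X n)" .
      qed
    qed
    from tendsto_add[OF this regular_dist_heat_tendsto[OF \<phi> \<phi>_fin \<psi>]]
    show "((\<lambda>t. regular_dist (u t) \<psi>) \<longlongrightarrow> regular_dist \<phi> \<psi>) (at_right 0)" by simp
  qed
qed

section \<open>The self-similar solution\<close>

lemma homogeneous_data_weighted_integrable:
  fixes \<omega> :: "'a::euclidean_space \<Rightarrow> 'b::euclidean_space"
  assumes \<omega> [measurable]: "\<omega> \<in> borel_measurable lebesgue" and bdd: "Lq_norm \<infinity> \<omega> < \<infinity>"
    and b: "0 \<le> \<beta>" "\<beta> < real DIM('a)"
  shows "(\<integral>\<^sup>+x. ennreal (norm (norm x powr (- \<beta>) *\<^sub>R \<omega> x) * decay x) \<partial>lebesgue) < \<infinity>"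
proof -
  have [measurable]: "decay \<in> borel_measurable (lebesgue :: 'a measure)"
    by (rule measurable_completion) simp
  obtain C where C: "esssup lebesgue (\<lambda>x. ennreal (norm (\<omega> x))) = ennreal C" "C \<ge> 0"
    using bdd by (cases "esssup lebesgue (\<lambda>x. ennreal (norm (\<omega> x)))") (auto simp: Lq_norm_def)
  have "(\<integral>\<^sup>+x. ennreal (norm (norm x powr (- \<beta>) *\<^sub>R \<omega> x) * decay x) \<partial>lebesgue)
      \<le> (\<integral>\<^sup>+x. ennreal C * ennreal (norm x powr (- \<beta>) * decay (x::'a)) \<partial>lebesgue)"
  proof (rule nn_integral_mono_AE, use esssup_AE[of "\<lambda>x. ennreal (norm (\<omega> x))" lebesgue] in eventually_elim)
    case (elim x)
    then have "norm (\<omega> x) \<le> C" using C by simp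
    then have "norm (\<omega> x) * (norm x powr (- \<beta>) * decay x) \<le> C * (norm x powr (- \<beta>) * decay x)"
      using decay_pos[of x] by (intro mult_right_mono) auto
    then show ?case
      using C(2) by (simp add: ennreal_mult'[symmetric] ennreal_leI mult_ac)
  qed
  also have "\<dots> = (\<integral>\<^sup>+x. ennreal C * ennreal (norm x powr (- \<beta>) * decay (x::'a)) \<partial>lborel)"
    by (rule nn_integral_completion)
  also have "\<dots> = ennreal C * (\<integral>\<^sup>+x. ennreal (norm x powr (- \<beta>) * decay (x::'a)) \<partial>lborel)"
    by (rule nn_integral_cmult) measurable
  also have "\<dots> < \<infinity>"
    using nn_integral_norm_powr_decay_finite[OF b] by (simp add: ennreal_mult_less_top)
  finally show ?thesis .
qed

text \<open>
  Existence and uniqueness in the closed ball of radius \<open>2 \<epsilon>\<close>, in the form in which they are applied.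
\<close>

lemma small_data_solution:
  fixes u0 :: "('a::euclidean_space \<Rightarrow> 'b::{real_normed_field,euclidean_space}) \<Rightarrow> 'b"
  assumes "small_data_constant TYPE('a \<Rightarrow> 'b) \<gamma> \<alpha> q s \<epsilon>" "tempered_distribution u0"
    "heat_Ks_norm \<gamma> \<alpha> q s u0 < ennreal \<epsilon>"
  obtains u where "u \<in> Ks \<gamma> \<alpha> q s" "Ks_norm \<gamma> \<alpha> q s u \<le> ennreal (2 * \<epsilon>)" "solution \<gamma> \<alpha> u0 u"
    "\<And>w t. w \<in> Ks \<gamma> \<alpha> q s \<Longrightarrow> Ks_norm \<gamma> \<alpha> q s w \<le> ennreal (2 * \<epsilon>) \<Longrightarrow>
      solution \<gamma> \<alpha> u0 w \<Longrightarrow> t > 0 \<Longrightarrow> AE x in lebesgue. w t x = u t x"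
proof -
  define S where "S = {u \<in> Ks \<gamma> \<alpha> q s. Ks_norm \<gamma> \<alpha> q s u \<le> ennreal (2 * \<epsilon>) \<and> solution \<gamma> \<alpha> u0 u}"
  have "S \<noteq> {} \<and> (\<forall>u\<in>S. \<forall>w\<in>S. \<forall>t>0. AE x in lebesgue. u t x = w t x)"
    using assms(1)[unfolded small_data_constant_def Let_def, THEN conjunct2, THEN spec, THEN mp,
        OF assms(2), THEN mp, OF assms(3)] unfolding S_def .
  then obtain u where u: "u \<in> S" and uniq: "\<And>w t. w \<in> S \<Longrightarrow> t > 0 \<Longrightarrow> AE x in lebesgue. w t x = u t x"
    by blast
  from u show thesis
    unfolding S_def by (elim CollectE conjE) (erule that, assumption+, rule uniq, auto simp: S_def)
qed

theorem theorem1p9: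
  fixes d :: nat and \<gamma> \<alpha> s \<epsilon>\<^sub>0 :: real and q :: ennreal
    and \<omega> \<phi> :: "'a::euclidean_space \<Rightarrow> 'b::{real_normed_field,euclidean_space}"
  assumes d: "d = DIM('a)"
    and \<gamma>: "\<gamma> > - min 2 (real d)"
    and \<alpha>: "\<alpha> > 1 + (2 + \<gamma>) / real d"
    and q1: "1 \<le> q"
    and q2: "ennreal \<alpha> \<le> q"
    and q3: "recip q < min (2 / (real d * (\<alpha> - 1)))
               (2 / (real d * (\<alpha> - 1)) +
                ((real d - 2) * \<alpha> - real d - \<gamma>) / (real d * (\<alpha> - 1)\<^sup>2))"
    and s1: "crit_s d \<gamma> \<alpha> q
               - (real d * (\<alpha> - 1) / \<alpha>) * (2 / (real d * (\<alpha> - 1)) - recip q) \<le> s"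
    and s2: "s < min (crit_s d \<gamma> \<alpha> q)
               (crit_s d \<gamma> \<alpha> q + ((real d - 2) * \<alpha> - real d - \<gamma>) / (\<alpha> * (\<alpha> - 1)))"
    and \<epsilon>\<^sub>0: "small_data_constant TYPE('a \<Rightarrow> 'b) \<gamma> \<alpha> q s \<epsilon>\<^sub>0"
    and \<omega>_meas: "\<omega> \<in> borel_measurable lebesgue"
    and \<omega>_bdd: "Lq_norm \<infinity> \<omega> < \<infinity>"
    and \<omega>_hom: "\<And>\<mu>::real. \<mu> > 0 \<Longrightarrow> AE x in lebesgue. \<omega> (\<mu> *\<^sub>R x) = \<omega> x"
    and \<phi>: "\<And>x. \<phi> x = (norm x powr (- ((2 + \<gamma>) / (\<alpha> - 1)))) *\<^sub>R \<omega> x"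
    and small: "heat_Ks_norm \<gamma> \<alpha> q s (regular_dist \<phi>) < ennreal \<epsilon>\<^sub>0"
  shows "\<exists>u. solution \<gamma> \<alpha> (regular_dist \<phi>) u \<and> self_similar \<gamma> \<alpha> u \<and>
             tends_to_initial u (regular_dist \<phi>)"
proof -
  define \<beta> where "\<beta> = (2 + \<gamma>) / (\<alpha> - 1)"
  have d0: "real d > 0" using d by simp
  have g2: "2 + \<gamma> > 0" using \<gamma> by linarith
  then have a1: "\<alpha> > 1" using \<alpha> d0 divide_pos_pos[of "2 + \<gamma>" "real d"] by linarith
  have \<beta>0: "\<beta> \<ge> 0" using g2 a1 by (simp add: \<beta>_def)
  have "2 + \<gamma> < real d * (\<alpha> - 1)"
    using \<alpha> d0 by (simp add: field_simps)
  then have \<beta>d: "\<beta> < real DIM('a)"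
    using a1 d by (simp add: \<beta>_def pos_divide_less_eq)
  have \<beta>a: "\<beta> * (\<alpha> - 1) = 2 + \<gamma>" using a1 by (simp add: \<beta>_def)
  have \<phi>_eq: "\<phi> = (\<lambda>x. norm x powr (- \<beta>) *\<^sub>R \<omega> x)" using \<phi> by (simp add: \<beta>_def fun_eq_iff)
  have [measurable]: "(\<lambda>x::'a. norm x powr (- \<beta>)) \<in> borel_measurable lebesgue"
    by (rule measurable_completion) measurable
  have \<phi>_meas: "\<phi> \<in> borel_measurable lebesgue"
    unfolding \<phi>_eq using \<omega>_meas by measurable
  have \<phi>_fin: "(\<integral>\<^sup>+x. ennreal (norm (\<phi> x) * decay x) \<partial>lebesgue) < \<infinity>"
    unfolding \<phi>_eq by (rule homogeneous_data_weighted_integrable[OF \<omega>_meas \<omega>_bdd \<beta>0 \<beta>d])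
  have \<phi>_hom: "AE x in lebesgue. k powr \<beta> *\<^sub>R \<phi> (k *\<^sub>R x) = \<phi> x" if k: "k > 0" for k
    using \<omega>_hom[OF k]
  proof eventually_elim
    case (elim x)
    have "k powr \<beta> * k powr (- \<beta>) = 1" using k by (simp add: powr_add[symmetric])
    then show ?case using k elim by (simp add: \<phi>_eq powr_mult mult.assoc[symmetric])
  qed
  have "tempered_distribution (regular_dist \<phi>)"
    using tempered_function_weighted[OF \<phi>_meas \<phi>_fin] by (simp add: tempered_function_def)
  then obtain u where uK: "u \<in> Ks \<gamma> \<alpha> q s" and ule: "Ks_norm \<gamma> \<alpha> q s u \<le> ennreal (2 * \<epsilon>\<^sub>0)"
    and sol: "solution \<gamma> \<alpha> (regular_dist \<phi>) u"
    and unique: "\<And>w t. w \<in> Ks \<gamma> \<alpha> q s \<Longrightarrow> Ks_norm \<gamma> \<alpha> q s w \<le> ennreal (2 * \<epsilon>\<^sub>0) \<Longrightarrow>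
      solution \<gamma> \<alpha> (regular_dist \<phi>) w \<Longrightarrow> t > 0 \<Longrightarrow> AE x in lebesgue. w t x = u t x"
    using small_data_solution[OF \<epsilon>\<^sub>0 _ small] by blast
  \<comment> \<open>every rescaling of \<open>u\<close> is a solution in the same ball with the same data\<close>
  have resc: "AE x in lebesgue. rescale \<beta> k u t x = u t x" if k: "k > 0" and t: "t > 0" for k t
  proof (rule unique[OF _ _ _ t])
    show "rescale \<beta> k u \<in> Ks \<gamma> \<alpha> q s" unfolding \<beta>_def by (rule rescale_Ks(2)[OF k q1 uK])
    show "Ks_norm \<gamma> \<alpha> q s (rescale \<beta> k u) \<le> ennreal (2 * \<epsilon>\<^sub>0)"
      unfolding \<beta>_def by (rule order_trans[OF rescale_Ks(1)[OF k q1 uK] ule])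
    show "solution \<gamma> \<alpha> (regular_dist \<phi>) (rescale \<beta> k u)"
      by (rule solution_rescale[OF k \<beta>a \<phi>_meas \<phi>_hom[OF k] sol])
  qed
  have ss: "self_similar \<gamma> \<alpha> u"
    unfolding self_similar_def
  proof (intro allI impI)
    fix k t :: real assume "k > 0" "t > 0"
    from resc[OF this]
    show "AE x in lebesgue. k powr ((2 + \<gamma>) / (\<alpha> - 1)) *\<^sub>R u (k\<^sup>2 * t) (k *\<^sub>R x) = u t x"
      by (simp add: rescale_def \<beta>_def)
  qed
  have "u t \<in> borel_measurable lebesgue" if "t > 0" for t
    using uK that by (simp add: Ks_def)
  then have "tends_to_initial u (regular_dist \<phi>)"
    by (rule self_similar_tends_to_initial[OF \<phi>_meas \<phi>_fin sol ss])
       (use \<beta>0 a1 in \<open>simp_all add: \<beta>_def\<close>)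
  with sol ss show ?thesis by blast
qed

end
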